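(* Let $\mathcal{G}=(V,D,B)$ be an acyclic mixed graph whose bidirected part $(V,B)$ is decomposable. Then $\mathcal{G}$ is strictly Gaussian causal, i.e., there exists an acyclic digraph $\mathcal{D}=(U,E)$ with $U\supseteq V$ such that $\mathbf{N}_V(\mathcal{D})=\mathbf{N}(\mathcal{G})$.
   Context: All vertex sets are finite. A mixed graph is a triple $\mathcal{G}=(V,D,B)$ with $D,B\subseteq V\times V$, where $(u,v)\in D$ is a directed edge $u\to v$ and $(u,v)\in B$ is a bidirected edge $u\leftrightarrow v$; $B$ is symmetric, and there are no self-loops, i.e. $(v,v)\notin D\cup B$. It is acyclic if the digraph $(V,D)$ has no directed cycles. The bidirected part is $(V,B)$, viewed as an undirected graph; it is decomposable (chordal) if it has no induced cycle of length more than three. Mixed graph model: let $\mathbb{R}^D$ be the set of $V\times V$ matrices $\Lambda=(\lambda_{uv})$ with $\lambda_{uv}=0$ whenever $u\to v\notin D$ (in particular zero diagonal), and let $\mathit{PD}(B)$ be the set of positive definite symmetric $V\times V$ matrices $\Omega=(\omega_{uv})$ with $\omega_{uv}=0$ whenever $u\neq v$ and $u\leftrightarrow v\notin B$. For $\mathcal{G}$ acyclic, $\mathbf{N}(\mathcal{G})$ is the family of all normal distributions $\mathcal{N}(\mu,\Sigma)$ on $\mathbb{R}^V$ with $\mu\in\mathbb{R}^V$ arbitrary and $\Sigma=(I-\Lambda)^{-T}\Omega(I-\Lambda)^{-1}$ for some $\Lambda\in\mathbb{R}^D$, $\Omega\in\mathit{PD}(B)$. Digraph model: for an acyclic digraph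 $\mathcal{D}=(U,E)$, $\mathbf{N}(\mathcal{D})$ is the family of all $\mathcal{N}(\mu,\Sigma)$ on $\mathbb{R}^U$ with $\Sigma=(I-\Lambda)^{-T}\Omega(I-\Lambda)^{-1}$, where $\Lambda\in\mathbb{R}^{E}$ (the $U\times U$ matrices supported on $E$) and $\Omega\in\mathbb{R}^{U\times U}$ is diagonal with positive diagonal entries. For $V\subseteq U$, $\mathbf{N}_V(\mathcal{D})$ is the set of $V$-marginals (on $\mathbb{R}^V$) of distributions in $\mathbf{N}(\mathcal{D})$. *)

theory Defs
  imports "HOL-Probability.Probability"
begin

section \<open>Graphs\<close>

definition mixed_graph :: "'a set \<Rightarrow> 'a rel \<Rightarrow> 'a rel \<Rightarrow> bool" where
  "mixed_graph V D B \<longleftrightarrow>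
     finite V \<and> D \<subseteq> V \<times> V \<and> B \<subseteq> V \<times> V \<and> sym B \<and> irrefl D \<and> irrefl B"

definition acyclic_mixed_graph :: "'a set \<Rightarrow> 'a rel \<Rightarrow> 'a rel \<Rightarrow> bool" where
  "acyclic_mixed_graph V D B \<longleftrightarrow> mixed_graph V D B \<and> acyclic D"

definition acyclic_digraph :: "'a set \<Rightarrow> 'a rel \<Rightarrow> bool" where
  "acyclic_digraph U E \<longleftrightarrow> finite U \<and> E \<subseteq> U \<times> U \<and> acyclic E"

text \<open>The vertices of the cycle are listed in cyclic order; the equivalence says that two of
  them are adjacent exactly when they are cyclically consecutive, i.e. the cycle is induced.\<close>

definition induced_cycle :: "'a set \<Rightarrow> 'a rel \<Rightarrow> 'a list \<Rightarrow> bool" where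
  "induced_cycle V B c \<longleftrightarrow>
     3 \<le> length c \<and> distinct c \<and> set c \<subseteq> V \<and>
     (\<forall>i<length c. \<forall>j<length c.
        (c ! i, c ! j) \<in> B \<longleftrightarrow> j = Suc i mod length c \<or> i = Suc j mod length c)"

definition decomposable :: "'a set \<Rightarrow> 'a rel \<Rightarrow> bool" where
  "decomposable V B \<longleftrightarrow> (\<nexists>c. induced_cycle V B c \<and> length c > 3)"

section \<open>Matrices with rows and columns indexed by a finite set\<close>

text \<open>A \<open>V \<times> V\<close> matrix is a function that vanishes outside \<open>V \<times> V\<close>, so that equality of
  matrices is equality of functions. The index set has to be a set rather than a type because
  the theorem quantifies existentially over the larger vertex set \<open>U\<close>.\<close>

type_synonym 'a mtx = "'a \<Rightarrow> 'a \<Rightarrow> real"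

definition mtx_supported :: "'a rel \<Rightarrow> 'a mtx set" where
  "mtx_supported R = {A. \<forall>u v. (u, v) \<notin> R \<longrightarrow> A u v = 0}"

definition mtx_one :: "'a set \<Rightarrow> 'a mtx" where
  "mtx_one V = (\<lambda>u v. if u = v \<and> u \<in> V then 1 else 0)"

definition mtx_minus :: "'a mtx \<Rightarrow> 'a mtx \<Rightarrow> 'a mtx" where
  "mtx_minus A B = (\<lambda>u v. A u v - B u v)"

definition mtx_mult :: "'a set \<Rightarrow> 'a mtx \<Rightarrow> 'a mtx \<Rightarrow> 'a mtx" where
  "mtx_mult V A B = (\<lambda>u v. \<Sum>w\<in>V. A u w * B w v)"

definition mtx_transpose :: "'a mtx \<Rightarrow> 'a mtx" where
  "mtx_transpose A = (\<lambda>u v. A v u)"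

text \<open>Unspecified if \<open>A\<close> is not invertible.\<close>

definition mtx_inv :: "'a set \<Rightarrow> 'a mtx \<Rightarrow> 'a mtx" where
  "mtx_inv V A = (THE A'. A' \<in> mtx_supported (V \<times> V) \<and>
     mtx_mult V A A' = mtx_one V \<and> mtx_mult V A' A = mtx_one V)"

definition mtx_det :: "'a set \<Rightarrow> 'a mtx \<Rightarrow> real" where
  "mtx_det V A = (\<Sum>p | p permutes V. of_int (sign p) * (\<Prod>i\<in>V. A i (p i)))"

definition quad_form :: "'a set \<Rightarrow> 'a mtx \<Rightarrow> ('a \<Rightarrow> real) \<Rightarrow> real" where
  "quad_form V A x = (\<Sum>u\<in>V. \<Sum>v\<in>V. x u * A u v * x v)"

definition positive_definite :: "'a set \<Rightarrow> 'a mtx \<Rightarrow> bool" where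
  "positive_definite V A \<longleftrightarrow>
     A \<in> mtx_supported (V \<times> V) \<and> mtx_transpose A = A \<and>
     (\<forall>x. (\<exists>v\<in>V. x v \<noteq> 0) \<longrightarrow> quad_form V A x > 0)"

section \<open>Multivariate normal distributions\<close>

text \<open>The space of real vectors indexed by \<open>V\<close> is \<open>Pi\<^sub>M V (\<lambda>_. lborel)\<close>, whose points are the
  functions extensional on \<open>V\<close>. The distribution with mean \<open>m\<close> and positive definite covariance
  matrix \<open>S\<close> is given by its Lebesgue density; all covariance matrices in the models below are
  positive definite. Only the values of \<open>m\<close> on \<open>V\<close> matter.\<close>

definition mv_normal_density ::
  "'a set \<Rightarrow> ('a \<Rightarrow> real) \<Rightarrow> 'a mtx \<Rightarrow> ('a \<Rightarrow> real) \<Rightarrow> real" where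
  "mv_normal_density V m S x =
     1 / sqrt ((2 * pi) ^ card V * mtx_det V S) *
     exp (- quad_form V (mtx_inv V S) (\<lambda>v. x v - m v) / 2)"

definition mv_normal :: "'a set \<Rightarrow> ('a \<Rightarrow> real) \<Rightarrow> 'a mtx \<Rightarrow> ('a \<Rightarrow> real) measure" where
  "mv_normal V m S =
     density (Pi\<^sub>M V (\<lambda>_. lborel)) (\<lambda>x. ennreal (mv_normal_density V m S x))"

definition marginal :: "'a set \<Rightarrow> ('a \<Rightarrow> real) measure \<Rightarrow> ('a \<Rightarrow> real) measure" where
  "marginal V M = distr M (Pi\<^sub>M V (\<lambda>_. lborel)) (\<lambda>x. restrict x V)"

section \<open>Gaussian graphical models\<close>

definition model_cov :: "'a set \<Rightarrow> 'a mtx \<Rightarrow> 'a mtx \<Rightarrow> 'a mtx" where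
  "model_cov V \<Lambda> \<Omega> =
     (let C = mtx_inv V (mtx_minus (mtx_one V) \<Lambda>)
      in mtx_mult V (mtx_mult V (mtx_transpose C) \<Omega>) C)"

definition PD :: "'a set \<Rightarrow> 'a rel \<Rightarrow> 'a mtx set" where
  "PD V B = {\<Omega>. positive_definite V \<Omega> \<and> (\<forall>u v. u \<noteq> v \<and> (u, v) \<notin> B \<longrightarrow> \<Omega> u v = 0)}"

definition diag_pos :: "'a set \<Rightarrow> 'a mtx set" where
  "diag_pos U = {\<Omega> \<in> mtx_supported (Id_on U). \<forall>u\<in>U. \<Omega> u u > 0}"

definition mixed_graph_model :: "'a set \<Rightarrow> 'a rel \<Rightarrow> 'a rel \<Rightarrow> ('a \<Rightarrow> real) measure set" where
  "mixed_graph_model V D B =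
     {mv_normal V m (model_cov V \<Lambda> \<Omega>) | m \<Lambda> \<Omega>. \<Lambda> \<in> mtx_supported D \<and> \<Omega> \<in> PD V B}"

definition digraph_model :: "'a set \<Rightarrow> 'a rel \<Rightarrow> ('a \<Rightarrow> real) measure set" where
  "digraph_model U E =
     {mv_normal U m (model_cov U \<Lambda> \<Omega>) | m \<Lambda> \<Omega>. \<Lambda> \<in> mtx_supported E \<and> \<Omega> \<in> diag_pos U}"

definition digraph_marginal_model ::
  "'a set \<Rightarrow> 'a set \<Rightarrow> 'a rel \<Rightarrow> ('a \<Rightarrow> real) measure set" where
  "digraph_marginal_model V U E = marginal V ` digraph_model U E"

text \<open>The vertices of \<open>U - V\<close> are taken from the type \<open>'a\<close>. This is the intended notion only if
  that type is infinite, so that arbitrarily many new vertices are available.\<close>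

definition strictly_gaussian_causal :: "'a set \<Rightarrow> 'a rel \<Rightarrow> 'a rel \<Rightarrow> bool" where
  "strictly_gaussian_causal V D B \<longleftrightarrow>
     (\<exists>U E. V \<subseteq> U \<and> acyclic_digraph U E \<and>
            digraph_marginal_model V U E = mixed_graph_model V D B)"

end

theory Submission
  imports Defs
begin

text \<open>A simplicial vertex of a chordal graph can be eliminated from a positive definite matrix
  without fill-in, and every chordal graph has one. Hence a positive definite \<open>\<Omega>\<close> with
  chordal pattern \<open>B\<close> is a sum of rank one matrices \<open>l\<^sub>k l\<^sub>k\<^sup>T\<close>, one for each vertex \<open>k\<close>, with
  \<open>l\<^sub>k\<close> supported on a clique \<open>S k\<close> that depends only on the graph. Applying this to
  \<open>\<Omega> - \<epsilon> I\<close> shows that \<open>\<Omega>\<close> is the covariance of the noise obtained from independent noise on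
  \<open>V\<close> and one latent source for each \<open>k\<close> with children \<open>S k\<close>. Conversely, since the sets
  \<open>S k\<close> are cliques, such latent sources produce only covariances with pattern \<open>B\<close>.\<close>

section \<open>Positive definite matrices\<close>

text \<open>One latent parent for each bidirected edge would not do. On a triangle, take the
  all-ones matrix plus a small multiple of the identity: three latent parents with two children each
  would have to produce three off-diagonal entries 1, each at a cost of at least 2 in the trace,
  while the trace is only a little above 3. This is why a source gets a whole clique of children. A
  multiple of the identity is set aside because every vertex of a digraph model needs positive noise
  variance; factoring all of \<Omega> would leave nothing for the vertices of \<open>V\<close>. The
  latent variables are sources so that eliminating them leaves the directed coefficients on
  \<open>V\<close> untouched and changes only the noise covariance. Normal distributions are given
  by Lebesgue densities, so a marginal is an integral. Coordinates are integrated out one at a time,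
  which requires the inverse and the determinant of a covariance matrix in terms of those of the
  matrix with one row and column fewer.\<close>

definition mtx_restrict :: "'a set \<Rightarrow> 'a mtx \<Rightarrow> 'a mtx" where
  "mtx_restrict V A = (\<lambda>u v. if u \<in> V \<and> v \<in> V then A u v else 0)"

text \<open>\<open>mtx_inv\<close> is a definite description and says nothing until an inverse is
  known to exist. With a relation, inverses can be exhibited explicitly; the support condition makes
  them unique as functions.\<close>

definition is_mtx_inv :: "'a set \<Rightarrow> 'a mtx \<Rightarrow> 'a mtx \<Rightarrow> bool" where
  "is_mtx_inv V A K \<longleftrightarrow> K \<in> mtx_supported (V \<times> V) \<and>
     mtx_mult V A K = mtx_one V \<and> mtx_mult V K A = mtx_one V"

section \<open>Algebra of matrices indexed by a finite set\<close>

lemma mtx_mult_assoc: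
  "mtx_mult V (mtx_mult V A B) C = mtx_mult V A (mtx_mult V B C)"
proof (intro ext)
  fix u v
  have "(\<Sum>w\<in>V. (\<Sum>x\<in>V. A u x * B x w) * C w v) = (\<Sum>w\<in>V. \<Sum>x\<in>V. A u x * B x w * C w v)"
    by (simp add: sum_distrib_right)
  also have "\<dots> = (\<Sum>x\<in>V. \<Sum>w\<in>V. A u x * B x w * C w v)"
    by (rule sum.swap)
  also have "\<dots> = (\<Sum>x\<in>V. A u x * (\<Sum>w\<in>V. B x w * C w v))"
    by (simp add: sum_distrib_left mult.assoc)
  finally show "mtx_mult V (mtx_mult V A B) C u v = mtx_mult V A (mtx_mult V B C) u v"
    by (simp add: mtx_mult_def)
qed

lemma mtx_mult_one_left:
  assumes "finite V" "A \<in> mtx_supported (V \<times> V)"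
  shows "mtx_mult V (mtx_one V) A = A"
proof (intro ext)
  fix u v
  have "(\<Sum>w\<in>V. mtx_one V u w * A w v) = (\<Sum>w\<in>V. if u = w then A w v else 0)"
    by (rule sum.cong) (auto simp: mtx_one_def)
  also have "\<dots> = A u v"
    using assms by (auto simp: mtx_supported_def)
  finally show "mtx_mult V (mtx_one V) A u v = A u v"
    by (simp add: mtx_mult_def)
qed

lemma mtx_mult_one_right:
  assumes "finite V" "A \<in> mtx_supported (V \<times> V)"
  shows "mtx_mult V A (mtx_one V) = A"
proof (intro ext)
  fix u v
  have "(\<Sum>w\<in>V. A u w * mtx_one V w v) = (\<Sum>w\<in>V. if w = v then A u w else 0)"
    by (rule sum.cong) (auto simp: mtx_one_def)
  also have "\<dots> = A u v"
    using assms by (auto simp: mtx_supported_def)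
  finally show "mtx_mult V A (mtx_one V) u v = A u v"
    by (simp add: mtx_mult_def)
qed

lemma is_mtx_inv_unique:
  assumes "finite V" "is_mtx_inv V A K" "is_mtx_inv V A L"
  shows "K = L"
proof -
  have "K = mtx_mult V K (mtx_mult V A L)"
    using assms by (simp add: is_mtx_inv_def mtx_mult_one_right)
  also have "\<dots> = mtx_mult V (mtx_mult V K A) L"
    by (simp add: mtx_mult_assoc)
  also have "\<dots> = L"
    using assms by (simp add: is_mtx_inv_def mtx_mult_one_left)
  finally show ?thesis .
qed

lemma mtx_inv_eq:
  assumes "finite V" "is_mtx_inv V A K"
  shows "mtx_inv V A = K"
  unfolding mtx_inv_def is_mtx_inv_def[symmetric]
  using assms is_mtx_inv_unique by blast

lemma mtx_transpose_mult:
  "mtx_transpose (mtx_mult V A B) = mtx_mult V (mtx_transpose B) (mtx_transpose A)"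
  by (simp add: mtx_transpose_def mtx_mult_def mult.commute)

lemma mtx_transpose_one [simp]: "mtx_transpose (mtx_one V) = mtx_one V"
  by (auto simp: mtx_transpose_def mtx_one_def fun_eq_iff)

lemma is_mtx_inv_transpose:
  assumes "is_mtx_inv V A K"
  shows "is_mtx_inv V (mtx_transpose A) (mtx_transpose K)"
  using assms
  by (auto simp: is_mtx_inv_def mtx_transpose_mult[symmetric])
     (auto simp: mtx_transpose_def mtx_supported_def)

section \<open>Quadratic forms\<close>

lemma quad_form_cong:
  assumes "\<And>v. v \<in> V \<Longrightarrow> x v = y v"
  shows "quad_form V A x = quad_form V A y"
  unfolding quad_form_def by (intro sum.cong) (use assms in auto)

lemma quad_form_alt: "quad_form V A x = (\<Sum>u\<in>V. x u * (\<Sum>v\<in>V. A u v * x v))"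
  by (simp add: quad_form_def sum_distrib_left mult.assoc)

lemma quad_form_rank_one:
  "quad_form V (\<lambda>u v. g u * g v * c) x = c * (\<Sum>v\<in>V. g v * x v)\<^sup>2"
  unfolding quad_form_def power2_eq_square sum_product
  by (simp add: sum_distrib_left mult_ac)

lemma quad_form_add:
  "quad_form V (\<lambda>u v. A u v + B u v) x = quad_form V A x + quad_form V B x"
  by (simp add: quad_form_def algebra_simps sum.distrib)

lemma quad_form_sum:
  assumes "finite H"
  shows "quad_form V (\<lambda>u v. \<Sum>h\<in>H. A h u v) x = (\<Sum>h\<in>H. quad_form V (A h) x)"
  using assms
proof (induction H rule: finite_induct)
  case empty
  then show ?case by (simp add: quad_form_def)
next
  case (insert h H)
  then show ?case by (simp add: quad_form_add)
qed

lemma quad_form_diagonal: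
  assumes "finite V"
  shows "quad_form V (\<lambda>u v. if u = v \<and> u \<in> V then d u else 0) x = (\<Sum>u\<in>V. d u * (x u)\<^sup>2)"
  unfolding quad_form_def
proof (rule sum.cong[OF refl])
  fix u assume "u \<in> V"
  have "(\<Sum>v\<in>V. x u * (if u = v \<and> u \<in> V then d u else 0) * x v)
      = (\<Sum>v\<in>V. if u = v then x u * d u * x u else 0)"
    by (rule sum.cong) auto
  then show "(\<Sum>v\<in>V. x u * (if u = v \<and> u \<in> V then d u else 0) * x v) = d u * (x u)\<^sup>2"
    using assms \<open>u \<in> V\<close> by (simp add: power2_eq_square mult_ac)
qed

lemma quad_form_mono_set:
  assumes "finite U" "V \<subseteq> U" "\<And>u v. u \<notin> V \<or> v \<notin> V \<Longrightarrow> x u * A u v * x v = 0"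
  shows "quad_form U A x = quad_form V A x"
proof -
  have "quad_form U A x = (\<Sum>u\<in>V. \<Sum>v\<in>U. x u * A u v * x v)"
    unfolding quad_form_def
  proof (rule sum.mono_neutral_right[OF assms(1,2)], rule ballI)
    fix u assume "u \<in> U - V"
    then show "(\<Sum>v\<in>U. x u * A u v * x v) = 0"
      by (intro sum.neutral ballI assms(3)) simp
  qed
  also have "\<dots> = quad_form V A x"
    unfolding quad_form_def
  proof (rule sum.cong[OF refl], rule sum.mono_neutral_right[OF assms(1,2)], rule ballI)
    fix u v assume "v \<in> U - V"
    then show "x u * A u v * x v = 0"
      by (intro assms(3)) simp
  qed
  finally show ?thesis .
qed

lemma positive_definite_sym: "positive_definite V A \<Longrightarrow> A u v = A v u"
  unfolding positive_definite_def mtx_transpose_def by metis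

lemma positive_definiteD:
  "positive_definite V A \<Longrightarrow> v \<in> V \<Longrightarrow> x v \<noteq> 0 \<Longrightarrow> quad_form V A x > 0"
  unfolding positive_definite_def by blast

lemma positive_definite_restrict:
  assumes "finite U" "V \<subseteq> U" "positive_definite U A"
  shows "positive_definite V (mtx_restrict V A)"
  unfolding positive_definite_def
proof (intro conjI allI impI)
  show "mtx_restrict V A \<in> mtx_supported (V \<times> V)"
    by (auto simp: mtx_restrict_def mtx_supported_def)
  show "mtx_transpose (mtx_restrict V A) = mtx_restrict V A"
    using positive_definite_sym[OF assms(3)]
    by (auto simp: mtx_restrict_def mtx_transpose_def fun_eq_iff)
  fix x :: "'a \<Rightarrow> real" assume x: "\<exists>v\<in>V. x v \<noteq> 0"
  define y where "y = (\<lambda>v. if v \<in> V then x v else 0)"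
  have "quad_form V (mtx_restrict V A) x = quad_form V A y"
    unfolding quad_form_def by (intro sum.cong) (auto simp: mtx_restrict_def y_def)
  also have "\<dots> = quad_form U A y"
    by (rule quad_form_mono_set[symmetric]) (use assms in \<open>auto simp: y_def\<close>)
  also have "\<dots> > 0"
  proof -
    have "\<exists>v\<in>U. y v \<noteq> 0" using x assms(2) by (auto simp: y_def)
    then show ?thesis using assms(3) by (simp add: positive_definite_def)
  qed
  finally show "quad_form V (mtx_restrict V A) x > 0" .
qed

section \<open>Determinant and inverse of a bordered matrix\<close>

lemma mtx_det_cong:
  assumes "\<And>u v. u \<in> V \<Longrightarrow> v \<in> V \<Longrightarrow> A u v = B u v"
  shows "mtx_det V A = mtx_det V B"
  unfolding mtx_det_def
  by (intro sum.cong prod.cong arg_cong2[where f="(*)"] refl)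
     (auto intro!: assms dest: permutes_in_image)

text \<open>The two terms belonging to a permutation and its composition with the transposition
  of \<open>h\<close> and \<open>w\<close> cancel.\<close>

lemma mtx_det_repeated_row:
  assumes "finite V" "h \<notin> V" "w \<in> V"
  shows "(\<Sum>p | p permutes insert h V. of_int (sign p) * (A w (p h) * (\<Prod>i\<in>V. A i (p i)))) = (0::real)"
proof -
  let ?P = "{p. p permutes insert h V}"
  let ?f = "\<lambda>p. of_int (sign p) * (A w (p h) * (\<Prod>i\<in>V. A i (p i))) :: real"
  let ?t = "Transposition.transpose h w"
  have hw: "h \<noteq> w" using assms by auto
  have t: "?t permutes insert h V"
    using assms by (intro permutes_swap_id) auto
  have "sum ?f ?P = sum (\<lambda>p. ?f (p \<circ> ?t)) ?P"
    by (rule sum_permutations_compose_right[OF t])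
  also have "\<dots> = sum (\<lambda>p. - ?f p) ?P"
  proof (rule sum.cong)
    fix p assume p: "p \<in> ?P"
    have "permutation p" "permutation ?t"
      using p assms(1) by (auto simp: permutation_swap_id intro: permutes_imp_permutation)
    then have sgn: "sign (p \<circ> ?t) = - sign p"
      using hw by (simp add: sign_compose sign_swap_id)
    have "A w ((p \<circ> ?t) h) * (\<Prod>i\<in>V. A i ((p \<circ> ?t) i))
        = A w (p w) * (A w (p h) * (\<Prod>i\<in>V - {w}. A i ((p \<circ> ?t) i)))"
      using assms by (subst prod.remove[of _ w]) auto
    also have "(\<Prod>i\<in>V - {w}. A i ((p \<circ> ?t) i)) = (\<Prod>i\<in>V - {w}. A i (p i))"
      using assms by (intro prod.cong) (auto simp: Transposition.transpose_def)
    also have "A w (p w) * (A w (p h) * \<dots>) = A w (p h) * (\<Prod>i\<in>V. A i (p i))"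
      using assms by (subst (2) prod.remove[of _ w]) auto
    finally show "?f (p \<circ> ?t) = - ?f p" by (simp add: sgn)
  qed simp
  finally show ?thesis by (simp add: sum_negf)
qed

text \<open>The determinant is linear in row \<open>h\<close>. The combination of the other rows
  contributes determinants with a repeated row, which vanish; the remaining entry \<open>s\<close>
  in column \<open>h\<close> selects the permutations that fix \<open>h\<close>, and these are the
  permutations of \<open>V\<close>.\<close>

lemma mtx_det_insert:
  assumes V: "finite V" "h \<notin> V"
    and row: "\<And>v. v \<in> insert h V \<Longrightarrow> A h v = (\<Sum>w\<in>V. c w * A w v) + (if v = h then s else 0)"
  shows "mtx_det (insert h V) A = s * mtx_det V A"
proof -
  let ?P = "{p. p permutes insert h V}"
  let ?g = "\<lambda>p. \<Prod>i\<in>V. A i (p i)"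
  have fin: "finite ?P" using V by (intro finite_permutations) auto
  have "mtx_det (insert h V) A = (\<Sum>p\<in>?P. of_int (sign p) * (A h (p h) * ?g p))"
    using V by (simp add: mtx_det_def)
  also have "\<dots> = (\<Sum>p\<in>?P. (\<Sum>w\<in>V. c w * (of_int (sign p) * (A w (p h) * ?g p)))
                    + (if p h = h then of_int (sign p) * (s * ?g p) else 0))"
  proof (rule sum.cong)
    fix p assume "p \<in> ?P"
    then have ph: "p h \<in> insert h V"
      using permutes_in_image[of p "insert h V" h] by blast
    show "of_int (sign p) * (A h (p h) * ?g p) =
        (\<Sum>w\<in>V. c w * (of_int (sign p) * (A w (p h) * ?g p)))
                    + (if p h = h then of_int (sign p) * (s * ?g p) else 0)"
      unfolding row[OF ph]
      by (simp add: algebra_simps sum_distrib_left sum_distrib_right)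
  qed simp
  also have "\<dots> = (\<Sum>p\<in>?P. \<Sum>w\<in>V. c w * (of_int (sign p) * (A w (p h) * ?g p)))
      + (\<Sum>p\<in>?P. if p h = h then of_int (sign p) * (s * ?g p) else 0)"
    by (rule sum.distrib)
  also have "(\<Sum>p\<in>?P. \<Sum>w\<in>V. c w * (of_int (sign p) * (A w (p h) * ?g p)))
      = (\<Sum>w\<in>V. c w * (\<Sum>p\<in>?P. of_int (sign p) * (A w (p h) * ?g p)))"
    by (subst sum.swap) (simp add: sum_distrib_left)
  also have "\<dots> = 0"
    using mtx_det_repeated_row[OF V] by simp
  also have "(\<Sum>p\<in>?P. if p h = h then of_int (sign p) * (s * ?g p) else 0)
      = (\<Sum>p\<in>{p \<in> ?P. p h = h}. of_int (sign p) * (s * ?g p))"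
    using fin by (rule sum.inter_filter[symmetric])
  also have "{p \<in> ?P. p h = h} = {p. p permutes V}"
  proof (intro equalityI subsetI)
    fix p assume "p \<in> {p \<in> ?P. p h = h}"
    then show "p \<in> {p. p permutes V}"
      by (auto intro: permutes_superset)
  next
    fix p assume "p \<in> {p. p permutes V}"
    then show "p \<in> {p \<in> ?P. p h = h}"
      using V by (auto intro: permutes_subset simp: permutes_not_in)
  qed
  also have "(\<Sum>p | p permutes V. of_int (sign p) * (s * ?g p)) = s * mtx_det V A"
    unfolding mtx_det_def sum_distrib_left by (rule sum.cong) auto
  finally show ?thesis by simp
qed

text \<open>Inversion of a positive definite matrix by bordering: the new inverse is a rank one
  update of the old one along the vector \<open>g\<close>, and \<open>s\<close> is the Schur complement.\<close>

lemma positive_definite_border: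
  assumes V: "finite V" "h \<notin> V"
    and S: "positive_definite (insert h V) S"
    and K': "is_mtx_inv V (mtx_restrict V S) K'"
  obtains g s where "s > 0" "g h = -1" "\<And>v. v \<notin> insert h V \<Longrightarrow> g v = 0"
    "is_mtx_inv (insert h V) S (\<lambda>u v. K' u v + g u * g v * (1 / s))"
    "mtx_det (insert h V) S = s * mtx_det V S"
proof -
  note sym = positive_definite_sym[OF S]
  let ?U = "insert h V"
  \<comment> \<open>On \<open>V\<close> the vector \<open>g\<close> holds the regression
    coefficients of coordinate \<open>h\<close> on \<open>V\<close>. With \<open>-1\<close> at
    \<open>h\<close> it is annihilated by every row of \<open>S\<close> indexed by \<open>V\<close>,
    and \<open>s\<close> is the residual variance.\<close>
  define g where "g w = (if w = h then -1 else if w \<in> V then \<Sum>v\<in>V. K' w v * S v h else 0)" for w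
  define s where "s = S h h - (\<Sum>w\<in>V. S h w * g w)"
  define K where "K u v = K' u v + g u * g v * (1 / s)" for u v
  have K'0: "K' u v = 0" if "u \<notin> V \<or> v \<notin> V" for u v
    using K' that by (auto simp: is_mtx_inv_def mtx_supported_def)
  have "mtx_transpose (mtx_restrict V S) = mtx_restrict V S"
    unfolding mtx_transpose_def mtx_restrict_def by (intro ext) (use sym in simp)
  then have "is_mtx_inv V (mtx_restrict V S) (mtx_transpose K')"
    using is_mtx_inv_transpose[OF K'] by (simp only:)
  then have "mtx_transpose K' = K'"
    using is_mtx_inv_unique[OF V(1) K'] by metis
  then have K'sym: "K' u v = K' v u" for u v
    using fun_cong[OF fun_cong[of "mtx_transpose K'" K' v], of u] by (simp add: mtx_transpose_def)
  have SK': "(\<Sum>w\<in>V. S u w * K' w v) = (if u = v then 1 else 0)" if "u \<in> V" "v \<in> V" for u v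
  proof -
    have "(\<Sum>w\<in>V. S u w * K' w v) = mtx_mult V (mtx_restrict V S) K' u v"
      using that by (auto simp: mtx_mult_def mtx_restrict_def intro!: sum.cong)
    then show ?thesis using K' that by (auto simp: is_mtx_inv_def mtx_one_def)
  qed
  have Sg: "(\<Sum>w\<in>?U. S u w * g w) = (if u = h then - s else 0)" if "u \<in> ?U" for u
  proof (cases "u = h")
    case True
    then show ?thesis using V by (simp add: s_def) (simp add: g_def)
  next
    case False
    have "(\<Sum>w\<in>V. S u w * g w) = (\<Sum>w\<in>V. \<Sum>v\<in>V. S u w * K' w v * S v h)"
      using V by (auto simp: g_def sum_distrib_left mult.assoc intro!: sum.cong)
    also have "\<dots> = (\<Sum>v\<in>V. (\<Sum>w\<in>V. S u w * K' w v) * S v h)"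
      by (subst sum.swap) (simp add: sum_distrib_right)
    also have "\<dots> = (\<Sum>v\<in>V. if u = v then S v h else 0)"
      using SK' that False by (intro sum.cong) auto
    also have "\<dots> = S u h" using that False V by simp
    finally show ?thesis using False V by (simp add: g_def[of h])
  qed
  \<comment> \<open>As \<open>g h = -1\<close>, the form takes the value \<open>s\<close> at the
    nonzero vector \<open>g\<close>, so definiteness makes the Schur complement positive.\<close>
  have "quad_form ?U S g = (\<Sum>u\<in>?U. g u * (if u = h then - s else 0))"
    unfolding quad_form_alt by (rule sum.cong[OF refl]) (simp only: Sg)
  also have "\<dots> = (\<Sum>u\<in>?U. if u = h then - (g h * s) else 0)"
    by (rule sum.cong) auto
  also have "\<dots> = - (g h * s)" using V(1) by simp
  finally have "quad_form ?U S g = - (g h * s)" .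
  moreover have "quad_form ?U S g > 0"
    using S unfolding positive_definite_def by (auto simp: g_def)
  ultimately have s: "s > 0" by (simp add: g_def)
  have SK'h: "(\<Sum>w\<in>V. S h w * K' w v) = (if v \<in> V then g v else 0)" for v
    using V sym K'sym K'0 by (auto simp: g_def mult.commute intro!: sum.cong)
  have SK: "mtx_mult ?U S K = mtx_one ?U"
  proof (intro ext)
    fix u v
    show "mtx_mult ?U S K u v = mtx_one ?U u v"
    proof (cases "u \<in> ?U")
      case False
      then have "S u w = 0" for w
        using S by (auto simp: positive_definite_def mtx_supported_def)
      then show ?thesis using False by (simp add: mtx_mult_def mtx_one_def)
    next
      case True
      have "mtx_mult ?U S K u v
          = (\<Sum>w\<in>?U. S u w * K' w v) + (\<Sum>w\<in>?U. S u w * g w) * g v / s"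
        unfolding mtx_mult_def K_def sum_distrib_right sum_divide_distrib sum.distrib[symmetric]
        by (intro sum.cong refl) (simp add: algebra_simps)
      also have "(\<Sum>w\<in>?U. S u w * K' w v) = (\<Sum>w\<in>V. S u w * K' w v)"
        using V by (simp add: K'0)
      finally have eq: "mtx_mult ?U S K u v
          = (\<Sum>w\<in>V. S u w * K' w v) + (if u = h then - g v else 0)"
        using s by (simp add: Sg[OF True])
      show ?thesis
      proof (cases "u = h")
        case True
        then show ?thesis unfolding eq using SK'h V by (auto simp: mtx_one_def g_def)
      next
        case False
        then have "u \<in> V" using True by auto
        then show ?thesis unfolding eq using SK'[of u v] False K'0[of _ v]
          by (cases "v \<in> V") (auto simp: mtx_one_def)
      qed
    qed
  qed
  \<comment> \<open>For symmetric \<open>S\<close> and \<open>K\<close>, transposing one of the two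
    inverse identities gives the other.\<close>
  have "mtx_transpose K = K" using K'sym by (auto simp: K_def mtx_transpose_def fun_eq_iff)
  moreover have "mtx_transpose S = S" using S by (simp add: positive_definite_def)
  ultimately have "mtx_mult ?U K S = mtx_transpose (mtx_mult ?U S K)"
    by (simp add: mtx_transpose_mult)
  then have KS: "mtx_mult ?U K S = mtx_one ?U" by (simp add: SK)
  have "K \<in> mtx_supported (?U \<times> ?U)"
    using K'0 by (auto simp: mtx_supported_def K_def g_def)
  then have inv: "is_mtx_inv ?U S K" using SK KS by (simp add: is_mtx_inv_def)
  \<comment> \<open>By symmetry \<open>Sg\<close> also describes row \<open>h\<close>: it is the
    combination of the other rows with coefficients \<open>g\<close>, plus \<open>s\<close> in
    column \<open>h\<close>.\<close>
  have "mtx_det ?U S = s * mtx_det V S"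
  proof (rule mtx_det_insert[OF V])
    fix v assume v: "v \<in> ?U"
    have "(\<Sum>w\<in>?U. S v w * g w) = - S v h + (\<Sum>w\<in>V. g w * S w v)"
      using V sym by (simp add: g_def[of h] mult.commute)
    then show "S h v = (\<Sum>w\<in>V. g w * S w v) + (if v = h then s else 0)"
      using Sg[OF v] sym[of v h] by (auto split: if_splits)
  qed
  then show ?thesis
    using that[of s g] s inv by (auto simp: g_def K_def[abs_def])
qed

lemma positive_definite_inverse:
  assumes "finite V" "positive_definite V S"
  shows "is_mtx_inv V S (mtx_inv V S)"
proof -
  have "\<exists>K. is_mtx_inv V S K"
    using assms
  proof (induction V arbitrary: S rule: finite_induct)
    case empty
    then show ?case
      by (intro exI[of _ "\<lambda>_ _. 0"])
         (auto simp: is_mtx_inv_def mtx_supported_def mtx_mult_def mtx_one_def)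
  next
    case (insert h V)
    have "positive_definite V (mtx_restrict V S)"
      using insert.hyps insert.prems by (intro positive_definite_restrict) auto
    then obtain K' where "is_mtx_inv V (mtx_restrict V S) K'" using insert.IH by blast
    from positive_definite_border[OF insert.hyps insert.prems this] show ?case by blast
  qed
  then show ?thesis using mtx_inv_eq[OF assms(1)] by auto
qed

lemma mtx_mult_apply:
  assumes "finite V" "is_mtx_inv V A K" "u \<in> V"
  shows "(\<Sum>w\<in>V. A u w * (\<Sum>v\<in>V. K w v * x v)) = x u"
proof -
  have "(\<Sum>w\<in>V. A u w * (\<Sum>v\<in>V. K w v * x v)) = (\<Sum>w\<in>V. \<Sum>v\<in>V. A u w * K w v * x v)"
    by (simp add: sum_distrib_left mult.assoc)
  also have "\<dots> = (\<Sum>v\<in>V. mtx_mult V A K u v * x v)"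
    by (subst sum.swap) (simp add: mtx_mult_def sum_distrib_right)
  also have "\<dots> = (\<Sum>v\<in>V. if u = v then x v else 0)"
    using assms by (intro sum.cong) (auto simp: is_mtx_inv_def mtx_one_def)
  also have "\<dots> = x u" using assms by simp
  finally show ?thesis .
qed

text \<open>Let \<open>k\<close> be column \<open>v\<close> of the inverse \<open>K\<close>. In the
  inner product given by \<open>S\<close>, the product of \<open>x\<close> and \<open>k\<close> is
  \<open>x v\<close>, so Cauchy-Schwarz bounds the square of \<open>x v\<close> by
  \<open>K v v\<close> times the form at \<open>x\<close>. Summing over \<open>v\<close> yields an
  explicit constant, with no appeal to compactness or eigenvalues.\<close>

lemma positive_definite_ge_norm:
  assumes V: "finite V" and S: "positive_definite V S"
  obtains e where "e > 0" "\<And>x. quad_form V S x \<ge> e * (\<Sum>v\<in>V. (x v)\<^sup>2)"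
proof -
  define K where "K = mtx_inv V S"
  have K: "is_mtx_inv V S K" unfolding K_def by (rule positive_definite_inverse[OF V S])
  \<comment> \<open>A common bound for all \<open>K v v\<close>, at least 1 so that it can be
    divided by.\<close>
  define M where "M = 1 + (\<Sum>v\<in>V. \<bar>K v v\<bar>)"
  define t where "t = 1 / M"
  have M: "M \<ge> 1" by (simp add: M_def sum_nonneg)
  have t: "t > 0" using M by (simp add: t_def)
  have nonneg: "quad_form V S y \<ge> 0" for y
  proof (cases "\<exists>v\<in>V. y v \<noteq> 0")
    case True
    then show ?thesis using S by (auto simp: positive_definite_def less_imp_le)
  next
    case False
    then show ?thesis by (simp add: quad_form_def)
  qed
  have coord: "t * (x v)\<^sup>2 \<le> quad_form V S x" if v: "v \<in> V" for x v
  proof -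
    \<comment> \<open>Cauchy-Schwarz comes from expanding the form at \<open>x - a k\<close>. This
      \<open>a\<close> minimizes the resulting quadratic polynomial once \<open>K v v\<close> has
      been replaced by its bound \<open>M\<close>.\<close>
    define a where "a = t * x v"
    define k where "k w = (\<Sum>i\<in>V. K w i * (if i = v then 1 else 0))" for w
    have k: "k w = K w v" if "w \<in> V" for w
      using v V by (simp add: k_def if_distrib cong: if_cong)
    have Sk: "(\<Sum>w\<in>V. S u w * k w) = (if u = v then 1 else 0)" if "u \<in> V" for u
      unfolding k_def by (rule mtx_mult_apply[OF V K that])
    have 1: "(\<Sum>u\<in>V. \<Sum>w\<in>V. y u * S u w * k w) = y v" for y
    proof -
      have "(\<Sum>u\<in>V. \<Sum>w\<in>V. y u * S u w * k w) = (\<Sum>u\<in>V. y u * (\<Sum>w\<in>V. S u w * k w))"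
        by (simp add: sum_distrib_left mult.assoc)
      also have "\<dots> = (\<Sum>u\<in>V. if u = v then y u else 0)"
        by (intro sum.cong) (auto simp: Sk)
      finally show ?thesis using v V by simp
    qed
    have 2: "(\<Sum>u\<in>V. \<Sum>w\<in>V. k u * S u w * y w) = y v" for y
      using 1[of y] positive_definite_sym[OF S] by (subst sum.swap) (simp add: mult_ac)
    have "quad_form V S (\<lambda>w. x w - a * k w) =
        quad_form V S x - a * (\<Sum>u\<in>V. \<Sum>w\<in>V. x u * S u w * k w)
        - a * (\<Sum>u\<in>V. \<Sum>w\<in>V. k u * S u w * x w)
        + a\<^sup>2 * (\<Sum>u\<in>V. \<Sum>w\<in>V. k u * S u w * k w)"
      unfolding quad_form_def sum_distrib_left sum.distrib[symmetric] sum_subtractf[symmetric]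
      by (intro sum.cong refl) (simp add: algebra_simps power2_eq_square)
    also have "\<dots> = quad_form V S x - 2 * a * x v + a\<^sup>2 * K v v"
      using 1 2 v by (simp add: k)
    finally have "0 \<le> quad_form V S x - 2 * a * x v + a\<^sup>2 * K v v"
      using nonneg by metis
    moreover have "K v v \<le> M"
      using member_le_sum[of v V "\<lambda>v. \<bar>K v v\<bar>"] v V by (auto simp: M_def)
    then have "a\<^sup>2 * K v v \<le> a\<^sup>2 * M" by (intro mult_left_mono) auto
    moreover have "a\<^sup>2 * M = t * (x v)\<^sup>2"
      using M by (simp add: a_def t_def power2_eq_square)
    moreover have "2 * a * x v = 2 * (t * (x v)\<^sup>2)"
      by (simp add: a_def power2_eq_square)
    ultimately show ?thesis by linarith
  qed
  show ?thesis
  proof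
    \<comment> \<open>The summand 1 keeps the denominator positive when \<open>V\<close> is
      empty.\<close>
    show "t / (1 + real (card V)) > 0" using t by simp
    fix x
    have "t * (\<Sum>v\<in>V. (x v)\<^sup>2) \<le> (\<Sum>v\<in>V. quad_form V S x)"
      unfolding sum_distrib_left by (intro sum_mono coord)
    also have "\<dots> \<le> (1 + real (card V)) * quad_form V S x"
      using nonneg by (simp add: algebra_simps)
    finally show "t / (1 + real (card V)) * (\<Sum>v\<in>V. (x v)\<^sup>2) \<le> quad_form V S x"
      by (simp add: field_simps)
  qed
qed

text \<open>Only diagonal entries change, so the pattern is kept, and the lower bound by the squared
  norm leaves room for definiteness. The amount \<open>e\<close> will be the noise variance of the
  vertices in \<open>V\<close>.\<close>

lemma PD_minus_diagonal:
  assumes V: "finite V" and \<Omega>: "\<Omega> \<in> PD V B"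
  obtains e where "e > 0" "(\<lambda>u v. \<Omega> u v - (if u = v \<and> u \<in> V then e else 0)) \<in> PD V B"
proof -
  have pd: "positive_definite V \<Omega>" using \<Omega> by (simp add: PD_def)
  obtain d where d: "d > 0" "\<And>x. d * (\<Sum>v\<in>V. (x v)\<^sup>2) \<le> quad_form V \<Omega> x"
    using positive_definite_ge_norm[OF V pd] by blast
  \<comment> \<open>Taking off only half of \<open>d\<close> leaves a form that still dominates
    \<open>d / 2\<close> times the squared norm.\<close>
  define \<Omega>' where "\<Omega>' = (\<lambda>u v. \<Omega> u v - (if u = v \<and> u \<in> V then d / 2 else 0))"
  have "quad_form V \<Omega>' x > 0" if x: "\<exists>v\<in>V. x v \<noteq> 0" for x
  proof -
    obtain v where v: "v \<in> V" "x v \<noteq> 0" using x by blast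
    have "\<Omega> = (\<lambda>u v. \<Omega>' u v + (if u = v \<and> u \<in> V then d / 2 else 0))"
      by (simp add: \<Omega>'_def)
    then have "quad_form V \<Omega> x
        = quad_form V (\<lambda>u v. \<Omega>' u v + (if u = v \<and> u \<in> V then d / 2 else 0)) x"
      by (rule arg_cong)
    also have "\<dots> = quad_form V \<Omega>' x + d / 2 * (\<Sum>v\<in>V. (x v)\<^sup>2)"
      unfolding quad_form_add quad_form_diagonal[OF V] sum_distrib_left ..
    finally have "quad_form V \<Omega> x = quad_form V \<Omega>' x + d / 2 * (\<Sum>v\<in>V. (x v)\<^sup>2)" .
    moreover have "(\<Sum>v\<in>V. (x v)\<^sup>2) > 0"
      using V v by (intro sum_pos2[of V v]) auto
    then have "d / 2 * (\<Sum>v\<in>V. (x v)\<^sup>2) > 0" using d(1) by simp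
    ultimately show ?thesis using d(2)[of x] by simp
  qed
  moreover have "mtx_transpose \<Omega>' = \<Omega>'"
  proof (intro ext)
    fix u v
    show "mtx_transpose \<Omega>' u v = \<Omega>' u v"
      using positive_definite_sym[OF pd, of u v] by (auto simp: mtx_transpose_def \<Omega>'_def)
  qed
  moreover have "\<Omega>' u v = 0" if "u \<noteq> v" "(u, v) \<notin> B" for u v
    using \<Omega> that by (simp add: PD_def \<Omega>'_def)
  moreover have "\<Omega>' \<in> mtx_supported (V \<times> V)"
    using pd by (auto simp: positive_definite_def mtx_supported_def \<Omega>'_def)
  ultimately have "\<Omega>' \<in> PD V B" by (simp add: PD_def positive_definite_def)
  then show ?thesis using that[of "d / 2"] d(1) unfolding \<Omega>'_def by simp
qed

section \<open>Marginals of normal distributions\<close>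

lemma borel_measurable_mv_normal_density [measurable]:
  "mv_normal_density V m S \<in> borel_measurable (Pi\<^sub>M V (\<lambda>_. lborel))"
proof -
  have [measurable]: "(\<lambda>x. x v) \<in> borel_measurable (Pi\<^sub>M V (\<lambda>_. lborel))" if "v \<in> V" for v
    using measurable_component_singleton[OF that, of "\<lambda>_. lborel"] by simp
  show ?thesis
    unfolding mv_normal_density_def quad_form_def by measurable
qed

text \<open>The second factor is the conditional density of coordinate \<open>h\<close> given
  \<open>V\<close>. The rank one term of the bordered inverse completes the square in
  \<open>y\<close>, with the regression on \<open>V\<close> as mean, and the determinant factor
  \<open>s\<close> normalizes it. Hence \<sigma> is \<open>sqrt s\<close>, the same for all
  \<open>x\<close>.\<close>

lemma mv_normal_density_insert:
  assumes V: "finite V" "h \<notin> V" and S: "positive_definite (insert h V) S"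
  obtains \<mu> \<sigma> where "\<sigma> > 0"
    "\<And>x y. mv_normal_density (insert h V) m S (x(h := y)) =
       mv_normal_density V m (mtx_restrict V S) x * normal_density (\<mu> x) \<sigma> y"
proof -
  let ?U = "insert h V"
  define K' where "K' = mtx_inv V (mtx_restrict V S)"
  have "positive_definite V (mtx_restrict V S)"
    using V S by (intro positive_definite_restrict) auto
  then have K': "is_mtx_inv V (mtx_restrict V S) K'"
    unfolding K'_def using V(1) by (intro positive_definite_inverse)
  obtain g s where s: "s > 0" and gh: "g h = -1"
    and inv: "is_mtx_inv ?U S (\<lambda>u v. K' u v + g u * g v * (1 / s))"
    and det: "mtx_det ?U S = s * mtx_det V S"
    using positive_definite_border[OF V S K'] by blast
  have det': "mtx_det V (mtx_restrict V S) = mtx_det V S"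
    by (rule mtx_det_cong) (simp add: mtx_restrict_def)
  have K: "mtx_inv ?U S = (\<lambda>u v. K' u v + g u * g v * (1 / s))"
    using V(1) inv by (intro mtx_inv_eq) auto
  define \<mu> where "\<mu> x = m h + (\<Sum>v\<in>V. g v * (x v - m v))" for x
  have "mv_normal_density ?U m S (x(h := y)) =
       mv_normal_density V m (mtx_restrict V S) x * normal_density (\<mu> x) (sqrt s) y" for x y
  proof -
    define z where "z v = (x(h := y)) v - m v" for v
    have "quad_form ?U K' z = quad_form V K' z"
      by (rule quad_form_mono_set)
         (use V K' in \<open>auto simp: is_mtx_inv_def mtx_supported_def\<close>)
    also have "\<dots> = quad_form V K' (\<lambda>v. x v - m v)"
      by (rule quad_form_cong) (use V in \<open>auto simp: z_def\<close>)
    finally have 1: "quad_form ?U K' z = quad_form V K' (\<lambda>v. x v - m v)" .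
    have "(\<Sum>v\<in>V. g v * z v) = (\<Sum>v\<in>V. g v * (x v - m v))"
      by (rule sum.cong) (use V in \<open>auto simp: z_def\<close>)
    then have "(\<Sum>v\<in>?U. g v * z v) = - (y - \<mu> x)"
      using V gh by (simp add: \<mu>_def z_def[of h])
    then have "quad_form ?U (mtx_inv ?U S) z
        = quad_form V K' (\<lambda>v. x v - m v) + (y - \<mu> x)\<^sup>2 / s"
      unfolding K quad_form_add quad_form_rank_one 1 by (simp add: power2_commute)
    then have 2: "exp (- quad_form ?U (mtx_inv ?U S) z / 2)
        = exp (- quad_form V K' (\<lambda>v. x v - m v) / 2) * exp (- (y - \<mu> x)\<^sup>2 / (2 * (sqrt s)\<^sup>2))"
      using s by (simp add: exp_add[symmetric] field_simps)
    have 3: "sqrt ((2 * pi) ^ card ?U * mtx_det ?U S)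
        = sqrt ((2 * pi) ^ card V * mtx_det V S) * sqrt (2 * pi * (sqrt s)\<^sup>2)"
      using V s unfolding det real_sqrt_mult[symmetric] by (simp add: mult_ac)
    show ?thesis
      unfolding mv_normal_density_def normal_density_def z_def[symmetric] K'_def[symmetric] 2 3 det'
      by simp
  qed
  then show ?thesis using s by (intro that[of "sqrt s" \<mu>]) auto
qed

lemma nn_integral_normal_density:
  assumes "\<sigma> > 0"
  shows "(\<integral>\<^sup>+y. ennreal (normal_density \<mu> \<sigma> y) \<partial>lborel) = 1"
  using assms by (subst nn_integral_eq_integral) simp_all

text \<open>By Fubini and the factorization of the density, the inner integral over coordinate
  \<open>h\<close> is the total mass 1 of a univariate normal density.\<close>

lemma marginal_mv_normal_insert:
  assumes V: "finite V" "h \<notin> V" and S: "positive_definite (insert h V) S"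
  shows "marginal V (mv_normal (insert h V) m S) = mv_normal V m (mtx_restrict V S)"
proof -
  let ?U = "insert h V"
  let ?L = "\<lambda>_. lborel :: real measure"
  let ?f = "mv_normal_density ?U m S"
  let ?g = "mv_normal_density V m (mtx_restrict V S)"
  interpret product_sigma_finite ?L ..
  obtain \<mu> \<sigma> where \<sigma>: "\<sigma> > 0" and f: "\<And>x y. ?f (x(h := y)) = ?g x * normal_density (\<mu> x) \<sigma> y"
    by (rule mv_normal_density_insert[OF V S, of m], rule that)
  have [measurable]: "(\<lambda>x. restrict x V) \<in> measurable (Pi\<^sub>M ?U ?L) (Pi\<^sub>M V ?L)"
    by (rule measurable_restrict_subset) auto
  show ?thesis
    unfolding marginal_def
  proof (rule measure_eqI)
    show "sets (distr (mv_normal ?U m S) (Pi\<^sub>M V ?L) (\<lambda>x. restrict x V)) =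
        sets (mv_normal V m (mtx_restrict V S))"
      by (simp add: mv_normal_def)
    fix A assume "A \<in> sets (distr (mv_normal ?U m S) (Pi\<^sub>M V ?L) (\<lambda>x. restrict x V))"
    then have A[measurable]: "A \<in> sets (Pi\<^sub>M V ?L)" by simp
    have "emeasure (distr (mv_normal ?U m S) (Pi\<^sub>M V ?L) (\<lambda>x. restrict x V)) A
        = emeasure (mv_normal ?U m S) ((\<lambda>x. restrict x V) -` A \<inter> space (Pi\<^sub>M ?U ?L))"
      by (subst emeasure_distr) (auto simp: mv_normal_def)
    also have "\<dots> = (\<integral>\<^sup>+z. ennreal (?f z) *
        indicator ((\<lambda>x. restrict x V) -` A \<inter> space (Pi\<^sub>M ?U ?L)) z \<partial>Pi\<^sub>M ?U ?L)"
      unfolding mv_normal_def by (rule emeasure_density) measurable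
    also have "\<dots> = (\<integral>\<^sup>+z. ennreal (?f z) * indicator A (restrict z V) \<partial>Pi\<^sub>M ?U ?L)"
      by (rule nn_integral_cong) (simp add: indicator_def)
    also have "\<dots> = (\<integral>\<^sup>+x. (\<integral>\<^sup>+y. ennreal (?f (x(h := y))) * indicator A (restrict (x(h := y)) V) \<partial>lborel) \<partial>Pi\<^sub>M V ?L)"
      using V by (rule product_nn_integral_insert) measurable
    also have "\<dots> = (\<integral>\<^sup>+x. ennreal (?g x) * indicator A x \<partial>Pi\<^sub>M V ?L)"
    proof (rule nn_integral_cong)
      fix x assume x: "x \<in> space (Pi\<^sub>M V ?L)"
      have r: "restrict (x(h := y)) V = x" for y
        using x V by (auto simp: space_PiM PiE_def extensional_def fun_eq_iff restrict_def)
      have "(\<integral>\<^sup>+y. ennreal (?f (x(h := y))) * indicator A (restrict (x(h := y)) V) \<partial>lborel)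
          = (\<integral>\<^sup>+y. (ennreal (?g x) * indicator A x) * ennreal (normal_density (\<mu> x) \<sigma> y) \<partial>lborel)"
        unfolding f r ennreal_mult''[OF normal_density_nonneg] by (simp add: mult_ac)
      also have "\<dots> = ennreal (?g x) * indicator A x"
        using \<sigma> by (subst nn_integral_cmult) (simp_all add: nn_integral_normal_density)
      finally show "(\<integral>\<^sup>+y. ennreal (?f (x(h := y))) * indicator A (restrict (x(h := y)) V) \<partial>lborel)
          = ennreal (?g x) * indicator A x" .
    qed
    also have "\<dots> = emeasure (mv_normal V m (mtx_restrict V S)) A"
      unfolding mv_normal_def by (rule emeasure_density[symmetric]) measurable
    finally show "emeasure (distr (mv_normal ?U m S) (Pi\<^sub>M V ?L) (\<lambda>x. restrict x V)) A
        = emeasure (mv_normal V m (mtx_restrict V S)) A" .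
  qed
qed

lemma marginal_marginal:
  assumes "V \<subseteq> W" "W \<subseteq> U" "sets M = sets (Pi\<^sub>M U (\<lambda>_. lborel))"
  shows "marginal V (marginal W M) = marginal V M"
proof -
  have "(\<lambda>x. restrict x V) \<in> measurable (Pi\<^sub>M W (\<lambda>_. lborel)) (Pi\<^sub>M V (\<lambda>_. lborel :: real measure))"
    by (rule measurable_restrict_subset[OF assms(1)])
  moreover have "(\<lambda>x. restrict x W) \<in> measurable M (Pi\<^sub>M W (\<lambda>_. lborel :: real measure))"
    using measurable_restrict_subset[OF assms(2), of "\<lambda>_. lborel :: real measure"]
    by (simp add: measurable_cong_sets[OF assms(3) refl])
  ultimately show ?thesis
    unfolding marginal_def using assms(1) by (subst distr_distr) (auto simp: o_def Int_absorb1)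
qed

lemma marginal_mv_normal:
  assumes "finite U" "V \<subseteq> U" "positive_definite U S"
  shows "marginal V (mv_normal U m S) = mv_normal V m (mtx_restrict V S)"
proof -
  \<comment> \<open>The coordinates in \<open>H\<close> are removed one by one. The matrix is
    generalized because each removal replaces it by a principal submatrix.\<close>
  have "marginal V (mv_normal (V \<union> H) m S) = mv_normal V m (mtx_restrict V S)"
    if "finite H" "finite V" "V \<inter> H = {}" "positive_definite (V \<union> H) S" for H S
    using that
  proof (induction H arbitrary: S rule: finite_induct)
    case empty
    have "distr (mv_normal V m S) (Pi\<^sub>M V (\<lambda>_. lborel)) (\<lambda>x. restrict x V)
        = distr (mv_normal V m S) (mv_normal V m S) (\<lambda>x. x)"
      by (rule distr_cong) (auto simp: mv_normal_def space_PiM)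
    moreover have "mtx_restrict V S = S"
      using empty by (auto simp: positive_definite_def mtx_supported_def mtx_restrict_def fun_eq_iff)
    ultimately show ?case by (simp add: marginal_def distr_id)
  next
    case (insert h H)
    let ?W = "V \<union> H"
    have W: "finite ?W" "h \<notin> ?W" and S: "positive_definite (insert h ?W) S"
      using insert by auto
    have S': "positive_definite ?W (mtx_restrict ?W S)"
      using W S by (intro positive_definite_restrict) auto
    have "marginal V (mv_normal (insert h ?W) m S)
        = marginal V (marginal ?W (mv_normal (insert h ?W) m S))"
      by (rule marginal_marginal[symmetric]) (auto simp: mv_normal_def)
    also have "\<dots> = marginal V (mv_normal ?W m (mtx_restrict ?W S))"
      by (simp add: marginal_mv_normal_insert[OF W S])
    also have "\<dots> = mv_normal V m (mtx_restrict V (mtx_restrict ?W S))"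
      using insert S' by (intro insert.IH) auto
    also have "mtx_restrict V (mtx_restrict ?W S) = mtx_restrict V S"
      by (auto simp: mtx_restrict_def fun_eq_iff)
    finally show ?case by simp
  qed
  from this[of "U - V" S] assms show ?thesis
    by (simp add: finite_subset Un_absorb1)
qed

section \<open>Decomposable graphs\<close>

text \<open>A shortest path between \<open>x\<close> and \<open>y\<close> with interior in \<open>A\<close> closes up with \<open>v\<close> to an
  induced cycle.\<close>

lemma decomposable_common_neighbours_adjacent:
  assumes B: "sym B" "irrefl B" and dec: "decomposable V B"
    and A: "A \<subseteq> V" "v \<notin> A" "\<And>a. a \<in> A \<Longrightarrow> (v, a) \<notin> B"
    and xy: "v \<in> V" "x \<in> V" "y \<in> V" "(v, x) \<in> B" "(v, y) \<in> B" "x \<noteq> y"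
    and conn: "(x, a) \<in> B" "a \<in> A" "(b, y) \<in> B" "b \<in> A" "(a, b) \<in> (B \<inter> A \<times> A)\<^sup>*"
  shows "(x, y) \<in> B"
proof (rule ccontr)
  assume nxy: "(x, y) \<notin> B"
  \<comment> \<open>Steps of \<open>R\<close> start in \<open>A\<close> or at \<open>x\<close> and
    end in \<open>A\<close> or at \<open>y\<close>, so all interior vertices of an
    \<open>R\<close>-walk from \<open>x\<close> to \<open>y\<close> lie in \<open>A\<close> and are
    not adjacent to \<open>v\<close>.\<close>
  define R where "R = {(s, t) \<in> B. (s \<in> A \<or> s = x) \<and> (t \<in> A \<or> t = y)}"
  have "(a, b) \<in> R\<^sup>*"
    using conn(5) by (rule rtrancl_mono[THEN subsetD, rotated]) (auto simp: R_def)
  moreover have "(x, a) \<in> R" "(b, y) \<in> R" using conn by (auto simp: R_def)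
  ultimately have "(x, y) \<in> R\<^sup>*"
    by (meson converse_rtrancl_into_rtrancl rtrancl.rtrancl_into_rtrancl)
  then obtain n0 where n0: "(x, y) \<in> R ^^ n0" using rtrancl_imp_relpow by blast
  define n where "n = (LEAST n. (x, y) \<in> R ^^ n)"
  have n: "(x, y) \<in> R ^^ n" unfolding n_def using n0 by (rule LeastI)
  have least: "n \<le> m" if "(x, y) \<in> R ^^ m" for m unfolding n_def using that by (rule Least_le)
  obtain f where f: "f 0 = x" "f n = y" "\<And>i. i < n \<Longrightarrow> (f i, f (Suc i)) \<in> R"
    using n unfolding relpow_fun_conv by blast
  have sub: "(f i, f j) \<in> R ^^ (j - i)" if "i \<le> j" "j \<le> n" for i j
    unfolding relpow_fun_conv using that by (intro exI[of _ "\<lambda>t. f (i + t)"]) (auto intro: f(3))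
  have "n \<noteq> 0" using f xy by metis
  moreover have "n \<noteq> 1" using f(1,2) f(3)[of 0] nxy by (auto simp: R_def)
  ultimately have n2: "n \<ge> 2" by linarith
  have src: "f i \<in> A \<or> f i = x" if "i < n" for i using f(3)[OF that] by (auto simp: R_def)
  have trg: "f i \<in> A \<or> f i = y" if "0 < i" "i \<le> n" for i
    using f(3)[of "i - 1"] that by (auto simp: R_def)
  have inner: "f i \<in> A" if "0 < i" "i < n" for i
    using src[of i] trg[of i] that xy(6) by auto
  have xA: "x \<notin> A" "y \<notin> A" using A xy by auto
  have vx: "v \<noteq> x" "v \<noteq> y" using xy B(2) by (auto simp: irrefl_def)
  have fv: "f i \<noteq> v" if "i \<le> n" for i
    using inner[of i] that f A(2) vx by (metis le_neq_implies_less not_gr_zero)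
  have fV: "f i \<in> V" if "i \<le> n" for i
    using inner[of i] that f A(1) xy by (metis le_neq_implies_less not_gr_zero subsetD)
  have vf: "(v, f i) \<in> B \<longleftrightarrow> i = 0 \<or> i = n" if "i \<le> n" for i
    using inner[of i] that f A(3) xy by (metis le_neq_implies_less not_gr_zero)
  \<comment> \<open>A repeated vertex, and likewise a chord in the next claim, would allow a
    shortcut, against the minimality of \<open>n\<close>.\<close>
  have inj: "f i \<noteq> f j" if "i < j" "j \<le> n" for i j
  proof
    assume "f i = f j"
    then have "(x, y) \<in> R ^^ (i + (n - j))"
      using sub[of 0 i] sub[of j n] that f(1,2) unfolding relpow_add by auto
    from least[OF this] that show False by linarith
  qed
  have chord: "(f i, f j) \<in> B \<longleftrightarrow> j = Suc i" if "i < j" "j \<le> n" for i j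
  proof
    assume "(f i, f j) \<in> B"
    then have "(f i, f j) \<in> R" using src[of i] trg[of j] that by (auto simp: R_def)
    then have "(f i, f j) \<in> R ^^ 1" by simp
    then have "(x, f j) \<in> R ^^ (i + 1)"
      using sub[of 0 i] that f(1) unfolding relpow_add by auto
    then have "(x, y) \<in> R ^^ (i + 1 + (n - j))"
      using sub[of j n] that f(2) unfolding relpow_add[of "i + 1"] by auto
    from least[OF this] that show "j = Suc i" by linarith
  next
    assume "j = Suc i"
    then show "(f i, f j) \<in> B" using f(3)[of i] that by (auto simp: R_def)
  qed
  have symB: "(s, t) \<in> B \<longleftrightarrow> (t, s) \<in> B" for s t using B(1) by (auto dest: symD)
  have irr: "(s, s) \<notin> B" for s using B(2) by (auto simp: irrefl_def)
  have chord': "(f i, f j) \<in> B \<longleftrightarrow> j = Suc i \<or> i = Suc j" if "i \<le> n" "j \<le> n" for i j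
  proof (cases i j rule: linorder_cases)
    case less
    then show ?thesis using chord[of i j] that by auto
  next
    case equal
    then show ?thesis using irr by simp
  next
    case greater
    then show ?thesis using chord[of j i] symB that by auto
  qed
  \<comment> \<open>Position 0 holds \<open>v\<close> and position \<open>Suc i\<close> holds
    \<open>f i\<close>. The length is \<open>n + 2\<close>, which exceeds 3 because
    \<open>n \<ge> 2\<close>.\<close>
  define c where "c = v # map f [0..<Suc n]"
  have len: "length c = Suc (Suc n)" by (simp add: c_def)
  have nth0: "c ! 0 = v" by (simp add: c_def)
  have nthS: "c ! Suc i = f i" if "i \<le> n" for i
    using that by (simp add: c_def del: upt_Suc)
  have md: "Suc (Suc i) mod length c = (if i = n then 0 else Suc (Suc i))" if "i \<le> n" for i
    using that by (auto simp: len)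
  have "induced_cycle V B c"
    unfolding induced_cycle_def
  proof (intro conjI allI impI)
    show "3 \<le> length c" using n2 by (simp add: len)
    have "inj_on f {0..<Suc n}"
      by (rule linorder_inj_onI') (use inj in auto)
    moreover have "v \<notin> f ` {0..<Suc n}" using fv less_Suc_eq_le by fastforce
    ultimately show "distinct c" by (simp add: c_def distinct_map del: upt_Suc)
    show "set c \<subseteq> V" using fV xy(1) by (auto simp: c_def simp del: upt_Suc)
    fix i j assume i: "i < length c" and j: "j < length c"
    have one: "Suc 0 mod length c = 1" by (simp add: len)
    show "(c ! i, c ! j) \<in> B \<longleftrightarrow> j = Suc i mod length c \<or> i = Suc j mod length c"
    proof (cases i)
      case 0
      show ?thesis
      proof (cases j)
        case 0
        then show ?thesis using \<open>i = 0\<close> irr one by (simp add: nth0)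
      next
        case (Suc b)
        then have "b \<le> n" using j len by simp
        then show ?thesis unfolding \<open>i = 0\<close> Suc nth0 nthS[OF \<open>b \<le> n\<close>] md[OF \<open>b \<le> n\<close>] one
          using vf by auto
      qed
    next
      case (Suc a)
      then have a: "a \<le> n" using i len by simp
      show ?thesis
      proof (cases j)
        case 0
        then show ?thesis unfolding 0 Suc nth0 nthS[OF a] md[OF a] one
          using vf[OF a] symB by auto
      next
        case (Suc b)
        then have b: "b \<le> n" using j len by simp
        show ?thesis unfolding \<open>i = Suc a\<close> Suc nthS[OF a] nthS[OF b] md[OF a] md[OF b]
          using chord'[OF a b] a b by auto
      qed
    qed
  qed
  with dec n2 show False by (auto simp: decomposable_def len)
qed

definition simplicial :: "'a set \<Rightarrow> 'a rel \<Rightarrow> 'a \<Rightarrow> bool" where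
  "simplicial V B k \<longleftrightarrow>
     (\<forall>u\<in>V. \<forall>v\<in>V. (k, u) \<in> B \<longrightarrow> (k, v) \<in> B \<longrightarrow> u \<noteq> v \<longrightarrow> (u, v) \<in> B)"

lemma decomposable_subset: "decomposable V B \<Longrightarrow> W \<subseteq> V \<Longrightarrow> decomposable W B"
  unfolding decomposable_def induced_cycle_def by blast

text \<open>Dirac's theorem, in a form suited to induction: the component of \<open>w\<close> in the graph
  without \<open>v\<close> and its neighbours is attached to the rest by a clique.\<close>

lemma decomposable_simplicial_nonadjacent:
  assumes "finite V" "sym B" "irrefl B" "decomposable V B"
    "v \<in> V" "w \<in> V" "v \<noteq> w" "(v, w) \<notin> B"
  shows "\<exists>z\<in>V. z \<noteq> v \<and> (v, z) \<notin> B \<and> simplicial V B z"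
  using assms
proof (induction V arbitrary: v w rule: finite_psubset_induct)
  case (psubset V)
  note B = psubset.prems(1,2)
  define A where "A = {a \<in> V. a \<noteq> v \<and> (v, a) \<notin> B}"
  define C where "C = {z. (w, z) \<in> (B \<inter> A \<times> A)\<^sup>*}"
  define S where "S = {x \<in> V. (v, x) \<in> B \<and> (\<exists>c\<in>C. (x, c) \<in> B)}"
  have wA: "w \<in> A" using psubset.prems by (auto simp: A_def)
  have wC: "w \<in> C" by (simp add: C_def)
  have CA: "C \<subseteq> A"
  proof
    fix z assume "z \<in> C"
    then have "(w, z) \<in> (B \<inter> A \<times> A)\<^sup>*" by (simp add: C_def)
    then show "z \<in> A" using wA by (induction rule: rtrancl_induct) auto
  qed
  \<comment> \<open>No vertex of \<open>C\<close> has a neighbour in \<open>V\<close> outside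
    \<open>C \<union> S\<close>. So a vertex of \<open>C\<close> that is simplicial in
    \<open>C \<union> S\<close> is simplicial in \<open>V\<close>, which is the content of
    \<open>lift\<close>.\<close>
  have nbr: "z \<in> C \<union> S" if "c \<in> C" "(c, z) \<in> B" "z \<in> V" for c z
  proof (cases "(v, z) \<in> B")
    case True
    then show ?thesis using that B(1) by (auto simp: S_def dest: symD)
  next
    case False
    have "z \<noteq> v" using that CA B(1) by (auto simp: A_def dest: symD)
    then have "z \<in> A" using False that by (auto simp: A_def)
    then have "(c, z) \<in> B \<inter> A \<times> A" using that CA by auto
    then have "z \<in> C" using that(1) by (auto simp: C_def intro: rtrancl.rtrancl_into_rtrancl)
    then show ?thesis by simp
  qed
  have conn: "(c, d) \<in> (B \<inter> A \<times> A)\<^sup>*" if "c \<in> C" "d \<in> C" for c d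
  proof -
    have "sym (B \<inter> A \<times> A)" using B(1) by (auto simp: sym_def)
    then have "(c, w) \<in> (B \<inter> A \<times> A)\<^sup>*"
      using that by (auto simp: C_def dest: symD[OF sym_rtrancl])
    then show ?thesis using that by (auto simp: C_def)
  qed
  have clique: "(x, y) \<in> B" if xy: "x \<in> S" "y \<in> S" "x \<noteq> y" for x y
  proof -
    obtain a b where ab: "a \<in> C" "(x, a) \<in> B" "b \<in> C" "(y, b) \<in> B" using xy by (auto simp: S_def)
    show ?thesis
      by (rule decomposable_common_neighbours_adjacent
          [OF B psubset.prems(3), of A v x y a b])
         (use xy ab CA conn[of a b] psubset.prems symD[OF B(1)] in \<open>auto simp: A_def S_def\<close>)
  qed
  have AV: "A \<subseteq> V" "v \<notin> A" "S \<subseteq> V" by (auto simp: A_def S_def)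
  have "v \<notin> S" using B(2) by (simp add: S_def irrefl_def)
  then have W: "C \<union> S \<subset> V" using CA AV psubset.prems(4) by blast
  have lift: ?case if "z \<in> C" "simplicial (C \<union> S) B z" for z
  proof (rule bexI[of _ z])
    show "z \<noteq> v \<and> (v, z) \<notin> B \<and> simplicial V B z"
    proof (intro conjI)
      show "z \<noteq> v" "(v, z) \<notin> B" using that(1) CA by (auto simp: A_def)
      show "simplicial V B z"
        using that(2) nbr[OF that(1)] unfolding simplicial_def by blast
    qed
    show "z \<in> V" using that(1) CA AV by blast
  qed
  note IH = psubset.IH[OF W B decomposable_subset[OF psubset.prems(3)]]
  show ?case
  proof (cases "\<forall>a\<in>C \<union> S. \<forall>b\<in>C \<union> S. a \<noteq> b \<longrightarrow> (a, b) \<in> B")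
    case True
    then have "simplicial (C \<union> S) B w" unfolding simplicial_def by blast
    then show ?thesis using lift wC by blast
  next
    case False
    then obtain a b where ab: "a \<in> C \<union> S" "b \<in> C \<union> S" "a \<noteq> b" "(a, b) \<notin> B" by blast
    from IH[OF _ ab] W obtain z where z: "z \<in> C \<union> S" "z \<noteq> a" "(a, z) \<notin> B"
      "simplicial (C \<union> S) B z" by blast
    show ?thesis
    proof (cases "z \<in> C")
      case True
      then show ?thesis using lift z by blast
    next
      case False
      \<comment> \<open>Here \<open>z\<close> lies in the clique \<open>S\<close>. The induction
        hypothesis, used again with \<open>z\<close> in the role of \<open>v\<close>, gives a
        simplicial vertex not adjacent to \<open>z\<close>, which therefore cannot lie in
        \<open>S\<close>.\<close>
      have "(z, a) \<notin> B" using z(3) B(1) by (auto dest: symD)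
      from IH[OF _ z(1) ab(1) z(2) this] W obtain y where y: "y \<in> C \<union> S" "y \<noteq> z" "(z, y) \<notin> B"
        "simplicial (C \<union> S) B y" by blast
      then have "y \<in> C" using clique[of z y] z(1) False by blast
      then show ?thesis using lift y by blast
    qed
  qed
qed

lemma decomposable_has_simplicial:
  assumes "finite V" "sym B" "irrefl B" "decomposable V B" "V \<noteq> {}"
  obtains k where "k \<in> V" "simplicial V B k"
proof (cases "\<exists>v\<in>V. \<exists>w\<in>V. v \<noteq> w \<and> (v, w) \<notin> B")
  case True
  then show ?thesis using decomposable_simplicial_nonadjacent[OF assms(1-4)] that by blast
next
  case False
  then have "simplicial V B k" for k unfolding simplicial_def by blast
  then show ?thesis using assms(5) that by blast
qed

section \<open>Cholesky factors supported on cliques\<close>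

lemma positive_definite_diag_pos:
  assumes "positive_definite V A" "finite V" "k \<in> V"
  shows "A k k > 0"
proof -
  let ?x = "\<lambda>v. if v = k then 1 else 0 :: real"
  have "quad_form V A ?x = quad_form {k} A ?x"
    by (rule quad_form_mono_set) (use assms in auto)
  also have "\<dots> = A k k" by (simp add: quad_form_def)
  finally show ?thesis using positive_definiteD[OF assms(1,3), of ?x] by simp
qed

text \<open>One pivot step. Off row and column \<open>k\<close>, the subtracted term is nonzero only
  at pairs of neighbours of \<open>k\<close>; distinct ones are adjacent since \<open>k\<close> is
  simplicial, so no entry outside the pattern is filled. Row and column \<open>k\<close> become
  zero.\<close>

lemma PD_eliminate_simplicial:
  assumes V: "finite V" "k \<in> V" and B: "sym B" and k: "simplicial V B k" and \<Omega>: "\<Omega> \<in> PD V B"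
  shows "(\<lambda>u v. \<Omega> u v - \<Omega> k u * \<Omega> k v * (1 / \<Omega> k k)) \<in> PD (V - {k}) B"
proof -
  define \<Omega>' where "\<Omega>' u v = \<Omega> u v - \<Omega> k u * \<Omega> k v * (1 / \<Omega> k k)" for u v
  have pd: "positive_definite V \<Omega>" and pat: "\<And>u v. u \<noteq> v \<Longrightarrow> (u, v) \<notin> B \<Longrightarrow> \<Omega> u v = 0"
    using \<Omega> by (auto simp: PD_def)
  note sym = positive_definite_sym[OF pd]
  have pos: "\<Omega> k k > 0" by (rule positive_definite_diag_pos[OF pd V])
  have supp: "\<Omega> u v = 0" if "u \<notin> V \<or> v \<notin> V" for u v
    using pd that by (auto simp: positive_definite_def mtx_supported_def)
  have elim: "\<Omega>' u v = 0" if "u = k \<or> v = k" for u v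
  proof (cases "u = k")
    case True
    then show ?thesis using pos by (simp add: \<Omega>'_def)
  next
    case False
    then have "v = k" using that by simp
    then have "\<Omega>' u v = \<Omega> u k - \<Omega> k u" using pos by (simp add: \<Omega>'_def)
    then show ?thesis using sym[of u k] by linarith
  qed
  have supp': "\<Omega>' u v = 0" if "u \<notin> V - {k} \<or> v \<notin> V - {k}" for u v
  proof (cases "u = k \<or> v = k")
    case True
    then show ?thesis by (rule elim)
  next
    case False
    then have "u \<notin> V \<or> v \<notin> V" using that by blast
    then show ?thesis by (auto simp: \<Omega>'_def supp)
  qed
  then have "\<Omega>' \<in> mtx_supported ((V - {k}) \<times> (V - {k}))"
    by (simp add: mtx_supported_def)
  moreover have "mtx_transpose \<Omega>' = \<Omega>'"
  proof (intro ext)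
    fix u v
    show "mtx_transpose \<Omega>' u v = \<Omega>' u v"
      using sym[of v u] by (simp add: mtx_transpose_def \<Omega>'_def)
  qed
  moreover have "quad_form (V - {k}) \<Omega>' x > 0" if x: "\<exists>v\<in>V - {k}. x v \<noteq> 0" for x
  proof -
    \<comment> \<open>The value at \<open>k\<close> makes row \<open>k\<close> of \<Omega>
      orthogonal to \<open>y\<close>, so the rank one term contributes nothing to the form at
      \<open>y\<close>.\<close>
    define y where "y = x(k := - (\<Sum>v\<in>V - {k}. \<Omega> k v * x v) / \<Omega> k k)"
    have "(\<Sum>v\<in>V. \<Omega> k v * y v) = \<Omega> k k * y k + (\<Sum>v\<in>V - {k}. \<Omega> k v * y v)"
      using V by (rule sum.remove)
    also have "(\<Sum>v\<in>V - {k}. \<Omega> k v * y v) = (\<Sum>v\<in>V - {k}. \<Omega> k v * x v)"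
      by (rule sum.cong) (auto simp: y_def)
    finally have 0: "(\<Sum>v\<in>V. \<Omega> k v * y v) = 0" using pos by (simp add: y_def)
    have "\<exists>v\<in>V. y v \<noteq> 0" using x by (auto simp: y_def)
    then have "0 < quad_form V \<Omega> y" using pd by (simp add: positive_definite_def)
    also have "\<Omega> = (\<lambda>u v. \<Omega>' u v + \<Omega> k u * \<Omega> k v * (1 / \<Omega> k k))"
      by (simp add: \<Omega>'_def fun_eq_iff)
    also have "quad_form V \<dots> y = quad_form V \<Omega>' y"
      unfolding quad_form_add quad_form_rank_one 0 by simp
    also have "\<dots> = quad_form (V - {k}) \<Omega>' y"
      by (rule quad_form_mono_set) (use V in \<open>auto simp: supp'\<close>)
    also have "\<dots> = quad_form (V - {k}) \<Omega>' x"
      by (rule quad_form_cong) (simp add: y_def)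
    finally show ?thesis .
  qed
  moreover have "\<Omega>' u v = 0" if uv: "u \<noteq> v" "(u, v) \<notin> B" for u v
  proof -
    have "\<Omega> k u * \<Omega> k v = 0" if "u \<noteq> k" "v \<noteq> k"
    proof (rule ccontr)
      assume "\<Omega> k u * \<Omega> k v \<noteq> 0"
      then have "\<Omega> k u \<noteq> 0" "\<Omega> k v \<noteq> 0" by auto
      then have "u \<in> V" "v \<in> V" "(k, u) \<in> B" "(k, v) \<in> B"
        using supp[of k u] supp[of k v] pat[of k u] pat[of k v] that by blast+
      then show False using k uv unfolding simplicial_def by blast
    qed
    then show ?thesis using elim[of u v] pat[OF uv]
      by (cases "u = k \<or> v = k") (auto simp: \<Omega>'_def)
  qed
  ultimately have "\<Omega>' \<in> PD (V - {k}) B" by (simp add: PD_def positive_definite_def)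
  then show ?thesis by (simp add: \<Omega>'_def[abs_def])
qed

text \<open>\<open>S\<close> is quantified before \<Omega> because one digraph has to serve all
  matrices in \<open>PD V B\<close>. This is possible as the elimination order comes from the graph
  alone: \<open>S k\<close> consists of \<open>k\<close> and those neighbours that remain when
  \<open>k\<close> is eliminated.\<close>

lemma decomposable_cholesky:
  assumes "finite V" "sym B" "irrefl B" "decomposable V B"
  shows "\<exists>S. (\<forall>k\<in>V. S k \<subseteq> V \<and> (\<forall>u\<in>S k. \<forall>v\<in>S k. u \<noteq> v \<longrightarrow> (u, v) \<in> B)) \<and>
    (\<forall>\<Omega>\<in>PD V B. \<exists>L. (\<forall>k\<in>V. \<forall>w. w \<notin> S k \<longrightarrow> L k w = 0) \<and>
       (\<forall>u v. \<Omega> u v = (\<Sum>k\<in>V. L k u * L k v)))"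
  using assms
proof (induction V rule: finite_psubset_induct)
  case (psubset V)
  note B = psubset.prems(1,2)
  show ?case
  proof (cases "V = {}")
    case True
    then show ?thesis by (auto simp: PD_def positive_definite_def mtx_supported_def)
  next
    case False
    from decomposable_has_simplicial[OF psubset.hyps psubset.prems False]
    obtain k where k: "k \<in> V" "simplicial V B k" .
    let ?W = "V - {k}"
    have W: "?W \<subset> V" using k by auto
    from psubset.IH[OF W B decomposable_subset[OF psubset.prems(3)]] obtain S where
      S: "\<forall>k\<in>?W. S k \<subseteq> ?W \<and> (\<forall>u\<in>S k. \<forall>v\<in>S k. u \<noteq> v \<longrightarrow> (u, v) \<in> B)"
      and L: "\<And>\<Omega>. \<Omega> \<in> PD ?W B \<Longrightarrow> \<exists>L. (\<forall>k\<in>?W. \<forall>w. w \<notin> S k \<longrightarrow> L k w = 0) \<and>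
       (\<forall>u v. \<Omega> u v = (\<Sum>k\<in>?W. L k u * L k v))" by auto
    let ?S = "S(k := insert k {u \<in> V. (k, u) \<in> B})"
    show ?thesis
    proof (intro exI[of _ ?S] conjI ballI)
      fix j assume j: "j \<in> V"
      show "?S j \<subseteq> V" using j k S by auto
      show "u \<noteq> v \<longrightarrow> (u, v) \<in> B" if "u \<in> ?S j" "v \<in> ?S j" for u v
      proof (cases "j = k")
        case True
        then show ?thesis using that k(2) B(1) unfolding simplicial_def by (auto dest: symD)
      next
        case False
        then show ?thesis using that S j by auto
      qed
    next
      fix \<Omega> assume \<Omega>: "\<Omega> \<in> PD V B"
      then have pd: "positive_definite V \<Omega>" by (simp add: PD_def)
      have pos: "\<Omega> k k > 0" by (rule positive_definite_diag_pos[OF pd psubset.hyps k(1)])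
      from L[OF PD_eliminate_simplicial[OF psubset.hyps k(1) B(1) k(2) \<Omega>]] obtain L where
        L0: "\<And>j w. j \<in> ?W \<Longrightarrow> w \<notin> S j \<Longrightarrow> L j w = 0" and
        L: "\<And>u v. \<Omega> u v - \<Omega> k u * \<Omega> k v * (1 / \<Omega> k k) = (\<Sum>j\<in>?W. L j u * L j v)" by blast
      \<comment> \<open>Row \<open>k\<close> divided by the root of its pivot; its products are the
        rank one term that was subtracted.\<close>
      let ?L = "L(k := \<lambda>w. \<Omega> k w / sqrt (\<Omega> k k))"
      show "\<exists>L. (\<forall>j\<in>V. \<forall>w. w \<notin> ?S j \<longrightarrow> L j w = 0) \<and>
        (\<forall>u v. \<Omega> u v = (\<Sum>k\<in>V. L k u * L k v))"
      proof (intro exI[of _ ?L] conjI ballI allI impI)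
        fix j w assume "j \<in> V" "w \<notin> ?S j"
        then show "?L j w = 0"
          using L0[of j w] \<Omega> by (auto simp: PD_def positive_definite_def mtx_supported_def)
      next
        fix u v
        have "(\<Sum>j\<in>V. ?L j u * ?L j v) = ?L k u * ?L k v + (\<Sum>j\<in>?W. ?L j u * ?L j v)"
          using psubset.hyps k(1) by (rule sum.remove)
        also have "(\<Sum>j\<in>?W. ?L j u * ?L j v) = (\<Sum>j\<in>?W. L j u * L j v)"
          by (rule sum.cong) auto
        also have "?L k u * ?L k v + \<dots> = \<Omega> u v"
          using pos by (simp add: L[symmetric])
        finally show "\<Omega> u v = (\<Sum>j\<in>V. ?L j u * ?L j v)" ..
      qed
    qed
  qed
qed

section \<open>Latent sources\<close>

definition I_minus :: "'a set \<Rightarrow> 'a mtx \<Rightarrow> 'a mtx" where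
  "I_minus V \<Lambda> = mtx_minus (mtx_one V) \<Lambda>"

lemma I_minus_mult:
  assumes "finite V" "u \<in> V"
  shows "mtx_mult V (I_minus V \<Lambda>) C u v = C u v - (\<Sum>w\<in>V. \<Lambda> u w * C w v)"
proof -
  have "mtx_mult V (I_minus V \<Lambda>) C u v
      = (\<Sum>w\<in>V. (if u = w then C w v else 0) - \<Lambda> u w * C w v)"
    unfolding mtx_mult_def I_minus_def mtx_minus_def mtx_one_def
    by (rule sum.cong) (auto simp: algebra_simps)
  also have "\<dots> = C u v - (\<Sum>w\<in>V. \<Lambda> u w * C w v)"
    using assms by (simp add: sum_subtractf)
  finally show ?thesis .
qed

lemma mult_I_minus:
  assumes "finite V" "v \<in> V"
  shows "mtx_mult V C (I_minus V \<Lambda>) u v = C u v - (\<Sum>w\<in>V. C u w * \<Lambda> w v)"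
proof -
  have "mtx_mult V C (I_minus V \<Lambda>) u v
      = (\<Sum>w\<in>V. (if v = w then C u w else 0) - C u w * \<Lambda> w v)"
    unfolding mtx_mult_def I_minus_def mtx_minus_def mtx_one_def
    by (rule sum.cong) (auto simp: algebra_simps)
  also have "\<dots> = C u v - (\<Sum>w\<in>V. C u w * \<Lambda> w v)"
    using assms by (simp add: sum_subtractf)
  finally show ?thesis .
qed

text \<open>Both products vanish outside \<open>V \<times> V\<close>, so the identities of functions
  reduce to scalar equations on \<open>V\<close>, with the products by the identity matrix already
  evaluated.\<close>

lemma is_mtx_inv_I_minus_iff:
  assumes "finite V" "\<Lambda> \<in> mtx_supported (V \<times> V)" "C \<in> mtx_supported (V \<times> V)"
  shows "is_mtx_inv V (I_minus V \<Lambda>) C \<longleftrightarrow>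
    (\<forall>u\<in>V. \<forall>v\<in>V. C u v - (\<Sum>w\<in>V. \<Lambda> u w * C w v) = (if u = v then 1 else 0)) \<and>
    (\<forall>u\<in>V. \<forall>v\<in>V. C u v - (\<Sum>w\<in>V. C u w * \<Lambda> w v) = (if u = v then 1 else 0))"
    (is "_ \<longleftrightarrow> ?l \<and> ?r")
proof -
  have out: "mtx_mult V A K u v = 0"
    if "A \<in> mtx_supported (V \<times> V)" "K \<in> mtx_supported (V \<times> V)" "u \<notin> V \<or> v \<notin> V"
    for A K :: "'a mtx" and u v
    using that by (auto simp: mtx_mult_def mtx_supported_def intro!: sum.neutral)
  have I: "I_minus V \<Lambda> \<in> mtx_supported (V \<times> V)"
    using assms(2) by (auto simp: I_minus_def mtx_minus_def mtx_one_def mtx_supported_def)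
  have eq: "M = mtx_one V \<longleftrightarrow> (\<forall>u\<in>V. \<forall>v\<in>V. M u v = (if u = v then 1 else 0))"
    if "\<And>u v. u \<notin> V \<or> v \<notin> V \<Longrightarrow> M u v = 0" for M :: "'a mtx"
    using that by (auto simp: mtx_one_def fun_eq_iff)
  have "mtx_mult V (I_minus V \<Lambda>) C = mtx_one V \<longleftrightarrow> ?l"
    by (subst eq[OF out[OF I assms(3)]]) (simp_all add: I_minus_mult assms(1))
  moreover have "mtx_mult V C (I_minus V \<Lambda>) = mtx_one V \<longleftrightarrow> ?r"
    by (subst eq[OF out[OF assms(3) I]]) (simp_all add: mult_I_minus assms(1))
  ultimately show ?thesis using assms(3) by (simp only: is_mtx_inv_def simp_thms)
qed

text \<open>As nothing points into \<open>H\<close>, the inverse has the block rows \<open>(C, 0)\<close> and \<open>(L C, I)\<close>, where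
  \<open>L\<close> is the \<open>H \<times> V\<close> block of \<open>\<Lambda>\<close>.\<close>

lemma is_mtx_inv_sources:
  assumes fin: "finite V" "finite H" and disj: "V \<inter> H = {}"
    and \<Lambda>: "\<Lambda> \<in> mtx_supported ((V \<union> H) \<times> V)"
    and C: "is_mtx_inv V (I_minus V (mtx_restrict V \<Lambda>)) C"
  shows "is_mtx_inv (V \<union> H) (I_minus (V \<union> H) \<Lambda>)
    (\<lambda>u v. C u v + (if u \<in> H then (if u = v then 1 else 0) + (\<Sum>w\<in>V. \<Lambda> u w * C w v) else 0))"
proof -
  let ?U = "V \<union> H"
  define K where "K u v = C u v + (if u \<in> H then (if u = v then 1 else 0)
    + (\<Sum>w\<in>V. \<Lambda> u w * C w v) else 0)" for u v
  have \<Lambda>0: "\<Lambda> u v = 0" if "v \<notin> V" for u v using \<Lambda> that by (auto simp: mtx_supported_def)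
  have \<Lambda>0': "\<Lambda> u v = 0" if "u \<notin> ?U" for u v using \<Lambda> that by (auto simp: mtx_supported_def)
  have Cs: "C \<in> mtx_supported (V \<times> V)" using C by (simp add: is_mtx_inv_def)
  then have C0: "C u v = 0" if "u \<notin> V \<or> v \<notin> V" for u v
    using that by (auto simp: mtx_supported_def)
  have "mtx_restrict V \<Lambda> \<in> mtx_supported (V \<times> V)"
    by (auto simp: mtx_restrict_def mtx_supported_def)
  from C[unfolded is_mtx_inv_I_minus_iff[OF fin(1) this Cs]]
  have l: "C u v - (\<Sum>w\<in>V. \<Lambda> u w * C w v) = (if u = v then 1 else 0)"
    and r: "C u v - (\<Sum>w\<in>V. C u w * \<Lambda> w v) = (if u = v then 1 else 0)"
    if "u \<in> V" "v \<in> V" for u v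
    using that by (simp_all add: mtx_restrict_def)
  have restr: "(\<Sum>w\<in>?U. f w) = (\<Sum>w\<in>V. f w)" if "\<And>w. w \<notin> V \<Longrightarrow> f w = 0" for f :: "'a \<Rightarrow> real"
    using fin that by (intro sum.mono_neutral_right) auto
  have KV: "K u v = C u v" if "u \<in> V" for u v using that disj by (auto simp: K_def)
  have Ks: "K \<in> mtx_supported (?U \<times> ?U)"
    using C0 by (auto simp: mtx_supported_def K_def intro!: sum.neutral)
  have "is_mtx_inv ?U (I_minus ?U \<Lambda>) K"
  proof (subst is_mtx_inv_I_minus_iff, goal_cases)
    case 1
    then show ?case using fin by simp
  next
    case 2
    then show ?case using \<Lambda>0 \<Lambda>0' by (auto simp: mtx_supported_def)
  next
    case 3
    then show ?case by (rule Ks)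
  next
    case 4
    show ?case
    proof (intro conjI ballI)
      fix u v assume u: "u \<in> ?U" and v: "v \<in> ?U"
      have "(\<Sum>w\<in>?U. \<Lambda> u w * K w v) = (\<Sum>w\<in>V. \<Lambda> u w * K w v)"
        by (rule restr) (simp add: \<Lambda>0)
      also have "\<dots> = (\<Sum>w\<in>V. \<Lambda> u w * C w v)" by (rule sum.cong) (auto simp: KV)
      finally have s: "(\<Sum>w\<in>?U. \<Lambda> u w * K w v) = (\<Sum>w\<in>V. \<Lambda> u w * C w v)" .
      show "K u v - (\<Sum>w\<in>?U. \<Lambda> u w * K w v) = (if u = v then 1 else 0)"
      proof (cases "u \<in> V")
        case True
        show ?thesis
        proof (cases "v \<in> V")
          case True
          then show ?thesis using l \<open>u \<in> V\<close> by (simp add: s KV)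
        next
          case False
          then show ?thesis using \<open>u \<in> V\<close> C0 by (auto simp: s KV)
        qed
      next
        case False
        then have "K u v = (if u = v then 1 else 0) + (\<Sum>w\<in>V. \<Lambda> u w * C w v)"
          using u C0[of u v] by (auto simp: K_def)
        then show ?thesis by (simp add: s)
      qed
      show "K u v - (\<Sum>w\<in>?U. K u w * \<Lambda> w v) = (if u = v then 1 else 0)"
      proof (cases "u \<in> V")
        case True
        have "(\<Sum>w\<in>?U. K u w * \<Lambda> w v) = (\<Sum>w\<in>V. C u w * \<Lambda> w v)"
          unfolding KV[OF True] by (rule restr) (simp add: C0)
        then show ?thesis
          using r[OF True, of v] True C0[of u v] \<Lambda>0[of v] by (cases "v \<in> V") (auto simp: KV)
      next
        case False
        then have uH: "u \<in> H" using u by simp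
        show ?thesis
        proof (cases "v \<in> V")
          case True
          have "(\<Sum>w\<in>?U. K u w * \<Lambda> w v)
              = (\<Sum>w\<in>?U. (if u = w then \<Lambda> w v else 0) + (\<Sum>x\<in>V. \<Lambda> u x * C x w) * \<Lambda> w v)"
            by (rule sum.cong) (use uH False C0 in \<open>auto simp: K_def algebra_simps\<close>)
          also have "\<dots> = \<Lambda> u v + (\<Sum>w\<in>?U. (\<Sum>x\<in>V. \<Lambda> u x * C x w) * \<Lambda> w v)"
            using fin u by (simp add: sum.distrib)
          also have "(\<Sum>w\<in>?U. (\<Sum>x\<in>V. \<Lambda> u x * C x w) * \<Lambda> w v)
              = (\<Sum>w\<in>V. (\<Sum>x\<in>V. \<Lambda> u x * C x w) * \<Lambda> w v)"
            by (rule restr) (simp add: C0)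
          also have "\<dots> = (\<Sum>x\<in>V. \<Lambda> u x * (\<Sum>w\<in>V. C x w * \<Lambda> w v))"
            unfolding sum_distrib_right sum_distrib_left
            by (subst sum.swap) (simp add: mult.assoc)
          \<comment> \<open>By \<open>r\<close>, the product of \<open>C\<close> and \<Lambda> on
            \<open>V\<close> is \<open>C - I\<close>. Multiplied by the block \<open>L\<close> from
            the left it is \<open>L C - L\<close>, whose \<open>- L\<close> cancels the term
            \<open>\<Lambda> u v\<close> split off above.\<close>
          also have "\<dots> = (\<Sum>x\<in>V. \<Lambda> u x * C x v - (if x = v then \<Lambda> u x else 0))"
          proof (rule sum.cong[OF refl])
            fix x assume "x \<in> V"
            then have "(\<Sum>w\<in>V. C x w * \<Lambda> w v) = C x v - (if x = v then 1 else 0)"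
              using r[OF _ True, of x] by (simp add: algebra_simps)
            then show "\<Lambda> u x * (\<Sum>w\<in>V. C x w * \<Lambda> w v) = \<Lambda> u x * C x v - (if x = v then \<Lambda> u x else 0)"
              by (simp add: right_diff_distrib)
          qed
          also have "\<dots> = (\<Sum>x\<in>V. \<Lambda> u x * C x v) - \<Lambda> u v"
            using fin True by (simp add: sum_subtractf)
          finally show ?thesis using uH False True C0 by (simp add: K_def)
        next
          case v: False
          then show ?thesis using uH False C0 \<Lambda>0 by (simp add: K_def)
        qed
      qed
    qed
  qed
  then show ?thesis by (simp add: K_def[abs_def])
qed

text \<open>A finite acyclic digraph has a vertex \<open>h\<close> without incoming edges. Regarded
  as a single source over \<open>V - {h}\<close>, it extends the inverse from the smaller vertex set
  by \<open>is_mtx_inv_sources\<close>.\<close>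

lemma acyclic_I_minus_inverse:
  assumes "finite V" "D \<subseteq> V \<times> V" "acyclic D" "\<Lambda> \<in> mtx_supported D"
  shows "is_mtx_inv V (I_minus V \<Lambda>) (mtx_inv V (I_minus V \<Lambda>))"
proof -
  have "\<exists>C. is_mtx_inv V (I_minus V \<Lambda>) C"
    using assms
  proof (induction V arbitrary: D \<Lambda> rule: finite_psubset_induct)
    case (psubset V)
    show ?case
    proof (cases "V = {}")
      case True
      then show ?thesis
        by (intro exI[of _ "\<lambda>_ _. 0"])
           (auto simp: is_mtx_inv_def mtx_supported_def mtx_mult_def mtx_one_def)
    next
      case False
      have "finite D" using finite_subset[OF psubset.prems(1)] psubset.hyps by simp
      then have "wf D" using psubset.prems(2) by (rule finite_acyclic_wf)
      with False obtain h where h: "h \<in> V" "\<And>y. (y, h) \<in> D \<Longrightarrow> y \<notin> V"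
        by (metis ex_in_conv wfE_min)
      let ?W = "V - {h}"
      have eq: "?W \<union> {h} = V" using h(1) by auto
      have "mtx_restrict ?W \<Lambda> \<in> mtx_supported (D \<inter> ?W \<times> ?W)"
        using psubset.prems(3) by (auto simp: mtx_restrict_def mtx_supported_def)
      moreover have "acyclic (D \<inter> ?W \<times> ?W)"
        using psubset.prems(2) by (rule acyclic_subset) auto
      ultimately obtain C where C: "is_mtx_inv ?W (I_minus ?W (mtx_restrict ?W \<Lambda>)) C"
        using psubset.IH[of ?W "D \<inter> ?W \<times> ?W" "mtx_restrict ?W \<Lambda>"] h(1) by blast
      have "(u, v) \<notin> D" if "u \<notin> V \<or> v \<notin> ?W" for u v
        using that psubset.prems(1) h(2) by blast
      then have "\<Lambda> \<in> mtx_supported ((?W \<union> {h}) \<times> ?W)"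
        using psubset.prems(3) unfolding eq by (auto simp: mtx_supported_def)
      from is_mtx_inv_sources[OF _ _ _ this C] psubset.hyps show ?thesis unfolding eq by auto
    qed
  qed
  then show ?thesis using mtx_inv_eq[OF assms(1)] by auto
qed

section \<open>Covariance matrices of the two models\<close>

lemma model_cov_eq:
  "model_cov V \<Lambda> \<Omega> = (\<lambda>u v. \<Sum>x\<in>V. (\<Sum>w\<in>V. mtx_inv V (I_minus V \<Lambda>) w u * \<Omega> w x)
     * mtx_inv V (I_minus V \<Lambda>) x v)"
  by (simp add: model_cov_def I_minus_def Let_def mtx_mult_def mtx_transpose_def)

text \<open>The form of the covariance at \<open>x\<close> is the form of \<Omega> at
  \<open>C x\<close>, where \<open>C\<close> is the inverse of \<open>I - \<Lambda>\<close>. As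
  \<open>C\<close> is injective, \<open>C x\<close> is nonzero whenever \<open>x\<close> is.\<close>

lemma positive_definite_model_cov:
  assumes V: "finite V" and \<Omega>: "positive_definite V \<Omega>"
    and inv: "is_mtx_inv V (I_minus V \<Lambda>) (mtx_inv V (I_minus V \<Lambda>))"
  shows "positive_definite V (model_cov V \<Lambda> \<Omega>)"
  unfolding positive_definite_def
proof (intro conjI allI impI)
  define C where "C = mtx_inv V (I_minus V \<Lambda>)"
  have cov: "model_cov V \<Lambda> \<Omega> = mtx_mult V (mtx_mult V (mtx_transpose C) \<Omega>) C"
    by (simp add: model_cov_def C_def I_minus_def Let_def)
  have C0: "C u v = 0" if "u \<notin> V \<or> v \<notin> V" for u v
    using inv that by (auto simp: is_mtx_inv_def C_def mtx_supported_def)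
  show "model_cov V \<Lambda> \<Omega> \<in> mtx_supported (V \<times> V)"
    using C0 by (auto simp: cov mtx_supported_def mtx_mult_def mtx_transpose_def intro!: sum.neutral)
  have "mtx_transpose \<Omega> = \<Omega>" using \<Omega> by (simp add: positive_definite_def)
  moreover have "mtx_transpose (mtx_transpose C) = C" by (simp add: mtx_transpose_def)
  ultimately show "mtx_transpose (model_cov V \<Lambda> \<Omega>) = model_cov V \<Lambda> \<Omega>"
    by (simp add: cov mtx_transpose_mult mtx_mult_assoc)
  fix x :: "'a \<Rightarrow> real" assume x: "\<exists>v\<in>V. x v \<noteq> 0"
  define y where "y u = (\<Sum>v\<in>V. C u v * x v)" for u
  have "\<exists>v\<in>V. y v \<noteq> 0"
  proof (rule ccontr)
    assume y0: "\<not> (\<exists>v\<in>V. y v \<noteq> 0)"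
    have "x u = 0" if "u \<in> V" for u
    proof -
      have "x u = (\<Sum>w\<in>V. I_minus V \<Lambda> u w * y w)"
        unfolding y_def C_def by (rule mtx_mult_apply[OF V inv that, symmetric])
      also have "\<dots> = 0" using y0 by (intro sum.neutral) auto
      finally show ?thesis .
    qed
    then show False using x by auto
  qed
  then have "0 < quad_form V \<Omega> y" using positive_definiteD[OF \<Omega>] by blast
  also have "quad_form V \<Omega> y = quad_form V (model_cov V \<Lambda> \<Omega>) x"
  proof -
    have "quad_form V \<Omega> y = (\<Sum>a\<in>V. \<Sum>b\<in>V. \<Sum>u\<in>V. \<Sum>v\<in>V. x u * (C a u * \<Omega> a b * C b v) * x v)"
      unfolding quad_form_def
    proof (intro sum.cong refl)
      fix a b
      have "y a * \<Omega> a b * y b = \<Omega> a b * (\<Sum>u\<in>V. \<Sum>v\<in>V. (C a u * x u) * (C b v * x v))"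
        unfolding y_def sum_product[symmetric] by (simp only: mult_ac)
      then show "y a * \<Omega> a b * y b = (\<Sum>u\<in>V. \<Sum>v\<in>V. x u * (C a u * \<Omega> a b * C b v) * x v)"
        by (simp add: sum_distrib_left mult_ac)
    qed
    \<comment> \<open>The sum over \<open>b\<close> stands outside that over \<open>a\<close> to
      match the unfolded nested \<open>mtx_mult\<close> in \<open>cov\<close>.\<close>
    also have "\<dots> = (\<Sum>u\<in>V. \<Sum>v\<in>V. \<Sum>b\<in>V. \<Sum>a\<in>V. x u * (C a u * \<Omega> a b * C b v) * x v)"
    proof -
      have "(\<Sum>a\<in>V. \<Sum>b\<in>V. \<Sum>u\<in>V. \<Sum>v\<in>V. F a b u v) = (\<Sum>u\<in>V. \<Sum>v\<in>V. \<Sum>b\<in>V. \<Sum>a\<in>V. F a b u v)"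
        for F :: "'a \<Rightarrow> 'a \<Rightarrow> 'a \<Rightarrow> 'a \<Rightarrow> real"
      proof -
        have "(\<Sum>a\<in>V. \<Sum>b\<in>V. \<Sum>u\<in>V. \<Sum>v\<in>V. F a b u v) = (\<Sum>p\<in>V\<times>V. \<Sum>q\<in>V\<times>V. F (fst p) (snd p) (fst q) (snd q))"
          by (simp add: sum.cartesian_product' case_prod_beta)
        also have "\<dots> = (\<Sum>q\<in>V\<times>V. \<Sum>p\<in>V\<times>V. F (fst p) (snd p) (fst q) (snd q))"
          by (rule sum.swap)
        also have "\<dots> = (\<Sum>u\<in>V. \<Sum>v\<in>V. \<Sum>a\<in>V. \<Sum>b\<in>V. F a b u v)"
          by (simp add: sum.cartesian_product' case_prod_beta)
        also have "\<dots> = (\<Sum>u\<in>V. \<Sum>v\<in>V. \<Sum>b\<in>V. \<Sum>a\<in>V. F a b u v)"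
          by (intro sum.cong refl sum.swap)
        finally show ?thesis .
      qed
      then show ?thesis .
    qed
    also have "\<dots> = quad_form V (model_cov V \<Lambda> \<Omega>) x"
      unfolding quad_form_def cov mtx_mult_def mtx_transpose_def sum_distrib_left sum_distrib_right ..
    finally show ?thesis .
  qed
  finally show "quad_form V (model_cov V \<Lambda> \<Omega>) x > 0" .
qed

text \<open>The covariance matrix of the noise of the mixed graph model which is induced by the
  latent variables \<open>H\<close> and the diagonal noise \<open>\<Omega>\<close> of the digraph model.\<close>

definition latent_noise :: "'a set \<Rightarrow> 'a set \<Rightarrow> 'a mtx \<Rightarrow> 'a mtx \<Rightarrow> 'a mtx" where
  "latent_noise V H \<Lambda> \<Omega> = (\<lambda>u v. (if u = v \<and> u \<in> V then \<Omega> u u else 0)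
     + (\<Sum>h\<in>H. \<Lambda> h u * \<Lambda> h v * \<Omega> h h))"

text \<open>The columns of the large inverse indexed by \<open>V\<close> have the blocks
  \<open>C\<close> and \<open>L C\<close>, where \<open>L\<close> is the block of \<Lambda> with
  rows in \<open>H\<close>. With diagonal \<Omega> the covariance on \<open>V\<close> is therefore
  the congruence by \<open>C\<close> of the noise on \<open>V\<close> plus
  \<open>L^T \<Omega> L\<close>, in which \<Omega> is restricted to \<open>H\<close>; that sum is
  \<open>latent_noise\<close>.\<close>

lemma restrict_model_cov:
  assumes fin: "finite V" "finite H" and disj: "V \<inter> H = {}"
    and \<Lambda>: "\<Lambda> \<in> mtx_supported ((V \<union> H) \<times> V)"
    and inv: "is_mtx_inv V (I_minus V (mtx_restrict V \<Lambda>)) (mtx_inv V (I_minus V (mtx_restrict V \<Lambda>)))"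
    and \<Omega>: "\<Omega> \<in> diag_pos (V \<union> H)"
  shows "mtx_restrict V (model_cov (V \<union> H) \<Lambda> \<Omega>)
    = model_cov V (mtx_restrict V \<Lambda>) (latent_noise V H \<Lambda> \<Omega>)"
proof (intro ext)
  fix u v
  let ?U = "V \<union> H"
  define C where "C = mtx_inv V (I_minus V (mtx_restrict V \<Lambda>))"
  define K where "K u v = C u v + (if u \<in> H then (if u = v then 1 else 0)
    + (\<Sum>w\<in>V. \<Lambda> u w * C w v) else 0)" for u v
  have C0: "C u v = 0" if "u \<notin> V \<or> v \<notin> V" for u v
    using inv that by (auto simp: is_mtx_inv_def C_def mtx_supported_def)
  have "is_mtx_inv ?U (I_minus ?U \<Lambda>) K"
    unfolding K_def[abs_def] C_def by (rule is_mtx_inv_sources[OF fin disj \<Lambda> inv])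
  then have K: "mtx_inv ?U (I_minus ?U \<Lambda>) = K" using fin by (intro mtx_inv_eq) auto
  have diag: "\<Omega> w x = 0" if "w \<noteq> x" for w x
  proof -
    have "(w, x) \<notin> Id_on ?U" using that by auto
    then show ?thesis using \<Omega> by (simp add: diag_pos_def mtx_supported_def)
  qed
  show "mtx_restrict V (model_cov ?U \<Lambda> \<Omega>) u v
    = model_cov V (mtx_restrict V \<Lambda>) (latent_noise V H \<Lambda> \<Omega>) u v"
  proof (cases "u \<in> V \<and> v \<in> V")
    case False
    then show ?thesis
      unfolding model_cov_eq C_def[symmetric]
      using C0 by (auto simp: mtx_restrict_def intro!: sum.neutral)
  next
    case True
    have KV: "K w x = C w x" if "w \<in> V" for w x using that disj by (auto simp: K_def)
    have KH: "K h x = (\<Sum>w\<in>V. \<Lambda> h w * C w x)" if "h \<in> H" "x \<in> V" for h x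
      using that disj C0[of h x] by (auto simp: K_def)
    have "mtx_restrict V (model_cov ?U \<Lambda> \<Omega>) u v
        = (\<Sum>x\<in>?U. (\<Sum>w\<in>?U. K w u * \<Omega> w x) * K x v)"
      using True by (simp add: mtx_restrict_def model_cov_eq K)
    also have "\<dots> = (\<Sum>x\<in>?U. K x u * \<Omega> x x * K x v)"
    proof (rule sum.cong[OF refl])
      fix x assume x: "x \<in> ?U"
      have "(\<Sum>w\<in>?U. K w u * \<Omega> w x) = (\<Sum>w\<in>?U. if w = x then K x u * \<Omega> x x else 0)"
        by (rule sum.cong) (auto simp: diag)
      then show "(\<Sum>w\<in>?U. K w u * \<Omega> w x) * K x v = K x u * \<Omega> x x * K x v"
        using fin x by simp
    qed
    also have "\<dots> = (\<Sum>x\<in>V. C x u * \<Omega> x x * C x v)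
        + (\<Sum>h\<in>H. (\<Sum>w\<in>V. \<Lambda> h w * C w u) * \<Omega> h h * (\<Sum>w\<in>V. \<Lambda> h w * C w v))"
      using fin disj True by (simp add: sum.union_disjoint KV KH)
    also have "\<dots> = (\<Sum>x\<in>V. (\<Sum>w\<in>V. C w u * latent_noise V H \<Lambda> \<Omega> w x) * C x v)"
    proof -
      have "(\<Sum>w\<in>V. C w u * latent_noise V H \<Lambda> \<Omega> w x)
          = C x u * \<Omega> x x + (\<Sum>h\<in>H. (\<Sum>w\<in>V. \<Lambda> h w * C w u) * \<Omega> h h * \<Lambda> h x)" if "x \<in> V" for x
      proof -
        have "(\<Sum>w\<in>V. C w u * latent_noise V H \<Lambda> \<Omega> w x)
            = (\<Sum>w\<in>V. (if w = x then C x u * \<Omega> x x else 0)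
                + (\<Sum>h\<in>H. \<Lambda> h w * C w u * \<Omega> h h * \<Lambda> h x))"
          by (rule sum.cong)
             (auto simp: latent_noise_def distrib_left sum_distrib_left mult_ac)
        also have "\<dots> = C x u * \<Omega> x x + (\<Sum>h\<in>H. \<Sum>w\<in>V. \<Lambda> h w * C w u * \<Omega> h h * \<Lambda> h x)"
          using fin that by (simp add: sum.distrib) (rule sum.swap)
        finally show ?thesis by (simp add: sum_distrib_right)
      qed
      then have "(\<Sum>x\<in>V. (\<Sum>w\<in>V. C w u * latent_noise V H \<Lambda> \<Omega> w x) * C x v)
          = (\<Sum>x\<in>V. C x u * \<Omega> x x * C x v
              + (\<Sum>h\<in>H. (\<Sum>w\<in>V. \<Lambda> h w * C w u) * \<Omega> h h * (\<Lambda> h x * C x v)))"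
        by (intro sum.cong) (simp_all add: distrib_right sum_distrib_right mult.assoc)
      also have "\<dots> = (\<Sum>x\<in>V. C x u * \<Omega> x x * C x v)
              + (\<Sum>h\<in>H. \<Sum>x\<in>V. (\<Sum>w\<in>V. \<Lambda> h w * C w u) * \<Omega> h h * (\<Lambda> h x * C x v))"
        unfolding sum.distrib by (subst sum.swap) (rule refl)
      finally show ?thesis by (simp add: sum_distrib_left)
    qed
    finally show ?thesis by (simp add: model_cov_eq C_def)
  qed
qed

text \<open>Each latent variable adds a nonnegative multiple of a square to the form, and the
  positive diagonal on \<open>V\<close> makes it definite. Off the diagonal, an entry needs a latent
  variable with both indices as children, and such indices are adjacent.\<close>

lemma latent_noise_PD:
  assumes fin: "finite V" "finite H" and disj: "V \<inter> H = {}"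
    and \<Omega>: "\<Omega> \<in> diag_pos (V \<union> H)"
    and supp: "\<And>h u. h \<in> H \<Longrightarrow> \<Lambda> h u \<noteq> 0 \<Longrightarrow> u \<in> V"
    and clique: "\<And>h u v. h \<in> H \<Longrightarrow> \<Lambda> h u \<noteq> 0 \<Longrightarrow> \<Lambda> h v \<noteq> 0 \<Longrightarrow> u \<noteq> v \<Longrightarrow> (u, v) \<in> B"
  shows "latent_noise V H \<Lambda> \<Omega> \<in> PD V B"
proof -
  let ?N = "latent_noise V H \<Lambda> \<Omega>"
  have pos: "\<Omega> u u > 0" if "u \<in> V \<union> H" for u using \<Omega> that by (auto simp: diag_pos_def)
  have "?N u v = 0" if "u \<notin> V \<or> v \<notin> V" for u v
  proof -
    have "\<Lambda> h u * \<Lambda> h v * \<Omega> h h = 0" if "h \<in> H" for h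
      using supp[OF that, of u] supp[OF that, of v] \<open>u \<notin> V \<or> v \<notin> V\<close> by auto
    then have "(\<Sum>h\<in>H. \<Lambda> h u * \<Lambda> h v * \<Omega> h h) = 0" by (intro sum.neutral ballI)
    then show ?thesis using that by (auto simp: latent_noise_def)
  qed
  then have "?N \<in> mtx_supported (V \<times> V)" by (auto simp: mtx_supported_def)
  moreover have "mtx_transpose ?N = ?N"
    by (auto simp: mtx_transpose_def latent_noise_def fun_eq_iff mult_ac intro!: sum.cong)
  moreover have "quad_form V ?N x > 0" if x: "\<exists>v\<in>V. x v \<noteq> 0" for x
  proof -
    obtain v where v: "v \<in> V" "x v \<noteq> 0" using x by blast
    have "quad_form V ?N x = quad_form V (\<lambda>u v. if u = v \<and> u \<in> V then \<Omega> u u else 0) x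
        + quad_form V (\<lambda>u v. \<Sum>h\<in>H. \<Lambda> h u * \<Lambda> h v * \<Omega> h h) x"
      unfolding latent_noise_def by (rule quad_form_add)
    also have "quad_form V (\<lambda>u v. if u = v \<and> u \<in> V then \<Omega> u u else 0) x = (\<Sum>u\<in>V. \<Omega> u u * (x u)\<^sup>2)"
      by (rule quad_form_diagonal[OF fin(1)])
    also have "quad_form V (\<lambda>u v. \<Sum>h\<in>H. \<Lambda> h u * \<Lambda> h v * \<Omega> h h) x
        = (\<Sum>h\<in>H. quad_form V (\<lambda>u v. \<Lambda> h u * \<Lambda> h v * \<Omega> h h) x)"
      using fin by (simp add: quad_form_sum)
    also have "\<dots> = (\<Sum>h\<in>H. \<Omega> h h * (\<Sum>v\<in>V. \<Lambda> h v * x v)\<^sup>2)"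
      by (simp add: quad_form_rank_one)
    finally have eq: "quad_form V ?N x = (\<Sum>u\<in>V. \<Omega> u u * (x u)\<^sup>2)
        + (\<Sum>h\<in>H. \<Omega> h h * (\<Sum>v\<in>V. \<Lambda> h v * x v)\<^sup>2)" .
    have "(\<Sum>u\<in>V. \<Omega> u u * (x u)\<^sup>2) > 0"
      using fin v pos by (intro sum_pos2[of V v]) (auto simp: less_imp_le)
    moreover have "(\<Sum>h\<in>H. \<Omega> h h * (\<Sum>v\<in>V. \<Lambda> h v * x v)\<^sup>2) \<ge> 0"
      using pos by (intro sum_nonneg) (auto simp: less_imp_le)
    ultimately show ?thesis by (simp add: eq)
  qed
  moreover have "?N u v = 0" if "u \<noteq> v" "(u, v) \<notin> B" for u v
  proof -
    have "\<Lambda> h u * \<Lambda> h v * \<Omega> h h = 0" if "h \<in> H" for h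
      using clique[OF that, of u v] \<open>u \<noteq> v\<close> \<open>(u, v) \<notin> B\<close> by auto
    then have "(\<Sum>h\<in>H. \<Lambda> h u * \<Lambda> h v * \<Omega> h h) = 0" by (intro sum.neutral ballI)
    then show ?thesis using that by (simp add: latent_noise_def)
  qed
  ultimately show ?thesis by (simp add: PD_def positive_definite_def)
qed

section \<open>The digraph with one latent source per clique\<close>

theorem theorem1p2:
  fixes V :: "'a set" and D B :: "'a rel"
  assumes "infinite (UNIV :: 'a set)"
    and "acyclic_mixed_graph V D B"
    and "decomposable V B"
  shows "strictly_gaussian_causal V D B"
proof -
  have finV: "finite V" and D: "D \<subseteq> V \<times> V" and "sym B" "irrefl B" and acD: "acyclic D"
    using assms(2) by (auto simp: acyclic_mixed_graph_def mixed_graph_def)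
  obtain S where S: "\<forall>k\<in>V. S k \<subseteq> V \<and> (\<forall>u\<in>S k. \<forall>v\<in>S k. u \<noteq> v \<longrightarrow> (u, v) \<in> B)"
    and chol: "\<forall>\<Omega>\<in>PD V B. \<exists>L. (\<forall>k\<in>V. \<forall>w. w \<notin> S k \<longrightarrow> L k w = 0) \<and>
       (\<forall>u v. \<Omega> u v = (\<Sum>k\<in>V. L k u * L k v))"
    using decomposable_cholesky[OF finV \<open>sym B\<close> \<open>irrefl B\<close> assms(3)] by (elim exE conjE) (rule that)
  \<comment> \<open>The infinite type supplies one new vertex for each vertex of \<open>V\<close>;
    \<kappa> tells which clique a latent vertex has as its children.\<close>
  have "infinite (UNIV - V)" using assms(1) finV by simp
  then obtain H where H: "H \<subseteq> UNIV - V" "finite H" "card H = card V"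
    using infinite_arbitrarily_large by blast
  then obtain \<kappa> where \<kappa>: "bij_betw \<kappa> H V" using finV finite_same_card_bij by metis
  have disj: "V \<inter> H = {}" using H(1) by auto
  have \<kappa>V: "\<kappa> h \<in> V" if "h \<in> H" for h using \<kappa> that by (auto simp: bij_betw_def)
  let ?U = "V \<union> H"
  define E where "E = D \<union> {(h, v). h \<in> H \<and> v \<in> S (\<kappa> h)}"
  have EV: "E \<subseteq> ?U \<times> V" unfolding E_def using D S \<kappa>V by blast
  have EUV: "(u, v) \<in> E \<longleftrightarrow> (u, v) \<in> D" if "u \<in> V" for u v using that disj by (auto simp: E_def)
  \<comment> \<open>All edges of \<open>E\<close> end in \<open>V\<close>, and those that start in
    \<open>V\<close> belong to \<open>D\<close>, so a cycle of \<open>E\<close> would be a cycle of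
    \<open>D\<close>.\<close>
  have "acyclic E"
  proof (rule acyclicI, rule allI, rule notI)
    fix x assume x: "(x, x) \<in> E\<^sup>+"
    have "y \<in> V \<and> (x, y) \<in> D\<^sup>+" if "(x, y) \<in> E\<^sup>+" "x \<in> V" for y
      using that
    proof (induction rule: trancl_induct)
      case (base y)
      then show ?case using EUV EV by auto
    next
      case (step y z)
      then have "(y, z) \<in> D" "z \<in> V" using EUV[of y z] EV by auto
      then show ?case using step by (auto intro: trancl_into_trancl)
    qed
    moreover have "x \<in> V" using x EV by (induction rule: tranclE) auto
    ultimately show False using x acD by (auto simp: acyclic_def)
  qed
  moreover have "finite ?U" using finV H(2) by simp
  ultimately have ac: "acyclic_digraph ?U E" using EV by (auto simp: acyclic_digraph_def)
  have marg: "marginal V (mv_normal ?U m (model_cov ?U \<Lambda> \<Omega>))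
      = mv_normal V m (model_cov V (mtx_restrict V \<Lambda>) (latent_noise V H \<Lambda> \<Omega>))"
    and restr: "mtx_restrict V \<Lambda> \<in> mtx_supported D"
    if \<Lambda>: "\<Lambda> \<in> mtx_supported E" and \<Omega>: "\<Omega> \<in> diag_pos ?U" for m \<Lambda> \<Omega>
  proof -
    show restr: "mtx_restrict V \<Lambda> \<in> mtx_supported D"
      using \<Lambda> EUV by (auto simp: mtx_restrict_def mtx_supported_def)
    have \<Lambda>': "\<Lambda> \<in> mtx_supported (?U \<times> V)" using \<Lambda> EV unfolding mtx_supported_def by blast
    have inv: "is_mtx_inv ?U (I_minus ?U \<Lambda>) (mtx_inv ?U (I_minus ?U \<Lambda>))"
      using acyclic_I_minus_inverse[of ?U E] ac \<Lambda> by (auto simp: acyclic_digraph_def)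
    \<comment> \<open>With an empty set of latent variables, \<open>latent_noise_PD\<close> yields
      the positive definiteness of the diagonal matrix \<Omega>.\<close>
    have "latent_noise ?U {} \<Lambda> \<Omega> \<in> PD ?U {}"
      using \<open>finite ?U\<close> \<Omega> by (intro latent_noise_PD) auto
    moreover have "latent_noise ?U {} \<Lambda> \<Omega> = \<Omega>"
    proof (intro ext)
      fix u v
      have "\<Omega> u v = 0" if "(u, v) \<notin> Id_on ?U" using \<Omega> that by (simp add: diag_pos_def mtx_supported_def)
      then show "latent_noise ?U {} \<Lambda> \<Omega> u v = \<Omega> u v" by (cases "u = v \<and> u \<in> ?U") (auto simp: latent_noise_def)
    qed
    ultimately have "positive_definite ?U \<Omega>" by (simp add: PD_def)
    from positive_definite_model_cov[OF \<open>finite ?U\<close> this inv]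
    have "marginal V (mv_normal ?U m (model_cov ?U \<Lambda> \<Omega>))
        = mv_normal V m (mtx_restrict V (model_cov ?U \<Lambda> \<Omega>))"
      by (intro marginal_mv_normal \<open>finite ?U\<close>) auto
    also have "mtx_restrict V (model_cov ?U \<Lambda> \<Omega>)
        = model_cov V (mtx_restrict V \<Lambda>) (latent_noise V H \<Lambda> \<Omega>)"
      by (rule restrict_model_cov[OF finV H(2) disj \<Lambda>' acyclic_I_minus_inverse[OF finV D acD restr] \<Omega>])
    finally show "marginal V (mv_normal ?U m (model_cov ?U \<Lambda> \<Omega>))
      = mv_normal V m (model_cov V (mtx_restrict V \<Lambda>) (latent_noise V H \<Lambda> \<Omega>))" .
  qed
  have "digraph_marginal_model V ?U E = mixed_graph_model V D B"
  proof (intro equalityI subsetI)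
    fix M assume "M \<in> digraph_marginal_model V ?U E"
    then obtain m \<Lambda> \<Omega> where M: "M = marginal V (mv_normal ?U m (model_cov ?U \<Lambda> \<Omega>))"
      and \<Lambda>: "\<Lambda> \<in> mtx_supported E" and \<Omega>: "\<Omega> \<in> diag_pos ?U"
      by (auto simp: digraph_marginal_model_def digraph_model_def)
    have ch: "u \<in> S (\<kappa> h)" if "h \<in> H" "\<Lambda> h u \<noteq> 0" for h u
    proof -
      have "(h, u) \<in> E" using that \<Lambda> unfolding mtx_supported_def by blast
      then show ?thesis using that disj D by (auto simp: E_def)
    qed
    have "latent_noise V H \<Lambda> \<Omega> \<in> PD V B"
    proof (rule latent_noise_PD[OF finV H(2) disj \<Omega>])
      show "u \<in> V" if "h \<in> H" "\<Lambda> h u \<noteq> 0" for h u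
        using ch[OF that] S \<kappa>V[OF that(1)] by blast
      show "(u, v) \<in> B" if "h \<in> H" "\<Lambda> h u \<noteq> 0" "\<Lambda> h v \<noteq> 0" "u \<noteq> v" for h u v
        using ch[OF that(1,2)] ch[OF that(1,3)] \<kappa>V[OF that(1)] that(4) S by blast
    qed
    then show "M \<in> mixed_graph_model V D B"
      unfolding mixed_graph_model_def M marg[OF \<Lambda> \<Omega>] using restr[OF \<Lambda> \<Omega>] by blast
  next
    fix M assume "M \<in> mixed_graph_model V D B"
    then obtain m \<Lambda> \<Omega> where M: "M = mv_normal V m (model_cov V \<Lambda> \<Omega>)"
      and \<Lambda>: "\<Lambda> \<in> mtx_supported D" and \<Omega>: "\<Omega> \<in> PD V B"
      by (auto simp: mixed_graph_model_def)
    obtain e where e: "e > 0" "(\<lambda>u v. \<Omega> u v - (if u = v \<and> u \<in> V then e else 0)) \<in> PD V B"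
      by (rule PD_minus_diagonal[OF finV \<Omega>], rule that)
    from chol[rule_format, OF e(2)] obtain L where
      L0: "\<And>k w. k \<in> V \<Longrightarrow> w \<notin> S k \<Longrightarrow> L k w = 0" and
      L: "\<And>u v. \<Omega> u v - (if u = v \<and> u \<in> V then e else 0) = (\<Sum>k\<in>V. L k u * L k v)" by blast
    \<comment> \<open>The factors \<open>L\<close> become the coefficients of the sources, whose
      variance can be 1 since \<open>L\<close> carries the scale. The vertices of \<open>V\<close>
      keep their directed coefficients and receive the variance \<open>e\<close> taken off
      \<Omega>.\<close>
    define \<Lambda>' where "\<Lambda>' u v = (if u \<in> H then L (\<kappa> u) v else \<Lambda> u v)" for u v
    define \<Omega>' where "\<Omega>' u v = (if u = v then if u \<in> V then e else if u \<in> H then 1 else 0 else 0)" for u v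
    have \<Lambda>'E: "\<Lambda>' \<in> mtx_supported E"
      using \<Lambda> L0 \<kappa>V by (auto simp: mtx_supported_def \<Lambda>'_def E_def)
    have \<Omega>'U: "\<Omega>' \<in> diag_pos ?U"
      using e by (auto simp: diag_pos_def mtx_supported_def \<Omega>'_def)
    have "\<Lambda> u v = 0" if "u \<notin> V \<or> v \<notin> V" for u v
      using \<Lambda> D that unfolding mtx_supported_def by blast
    then have "mtx_restrict V \<Lambda>' = \<Lambda>"
      using disj by (auto simp: mtx_restrict_def \<Lambda>'_def fun_eq_iff)
    moreover have "latent_noise V H \<Lambda>' \<Omega>' = \<Omega>"
    proof (intro ext)
      fix u v
      have "(\<Sum>h\<in>H. \<Lambda>' h u * \<Lambda>' h v * \<Omega>' h h) = (\<Sum>h\<in>H. L (\<kappa> h) u * L (\<kappa> h) v)"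
        by (rule sum.cong) (use disj in \<open>auto simp: \<Lambda>'_def \<Omega>'_def\<close>)
      also have "\<dots> = (\<Sum>k\<in>V. L k u * L k v)"
        using sum.reindex_bij_betw[OF \<kappa>, of "\<lambda>k. L k u * L k v"] .
      finally show "latent_noise V H \<Lambda>' \<Omega>' u v = \<Omega> u v"
        by (auto simp: latent_noise_def L[symmetric] \<Omega>'_def)
    qed
    ultimately have "M = marginal V (mv_normal ?U m (model_cov ?U \<Lambda>' \<Omega>'))"
      by (simp add: M marg[OF \<Lambda>'E \<Omega>'U])
    then show "M \<in> digraph_marginal_model V ?U E"
      using \<Lambda>'E \<Omega>'U unfolding digraph_marginal_model_def digraph_model_def by blast
  qed
  then show ?thesis
    unfolding strictly_gaussian_causal_def using ac by (intro exI[of _ ?U] exI[of _ E]) auto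
qed

end
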